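(* Let $G$ be a finite group, let $A,B\subseteq G\setminus\{1_G\}$ be generating sets of $G$ with $A=A^{-1}$, $B=B^{-1}$ and $gag^{-1}\ne b$ for all $a\in A$, $b\in B$, $g\in G$. Let $\mathbb{F}$ be a finite field, let $C_A\subseteq\mathbb{F}^A$ and $C_B\subseteq\mathbb{F}^B$ be nonzero linear codes, and let $\varepsilon\in(0,1]$. Suppose that: (1a$'$) $\delta(C_A)\ge\varepsilon$; (1b$'$) $\delta(C_B)\ge\varepsilon$; (1c$'$) $C_A\otimes C_B$ is $\varepsilon$-agreement testable; (2$'$) the Cayley graphs $\mathrm{Cay}(A,G)$ and $\mathrm{Cay}(G,B)$ are $\frac{\varepsilon^2}{2500}$-expanders. Let $\Sigma=C_A\otimes C_B$ and let $Z^0\subseteq\Sigma^G$ be the code $$Z^0=\{f\in\Sigma^G: r_a(f(g))=r_{a^{-1}}(f(ag))\text{ and }c_b(f(g))=c_{b^{-1}}(f(gb))\ \ \forall a\in A,b\in B,g\in G\}$$ with alphabet $\Sigma$. Then $$\delta(Z^0)\ge0.9996\,\varepsilon,\qquad r(Z^0)\ge\frac{4r(C_A)r(C_B)-3}{4r(C_A)r(C_B)},$$ and the natural $2$-query tester of $Z^0$ has soundness $$\frac{1}{\max\{\frac{|A|}{|B|},\frac{|B|}{|A|}\}\left[250000\,\varepsilon^{-3}+4800\max\{|A|,|B|\}\,\varepsilon^{-1}\right]}.$$ Moreover, setting $\eta=\frac{1}{250000\,\varepsilon^{-3}+4800\max\{|A|,|B|\}\varepsilon^{-1}}$, the Correction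 Algorithm with parameter $q=\frac{\varepsilon}{100}$ is a decoding algorithm for words that are $\eta$-close to $Z^0$ (i.e. given $f\in\Sigma^G$ with $\mathrm{dist}(f,Z^0)<\eta$, it outputs the unique $f'\in Z^0$ with $\mathrm{dist}(f,f')<\eta$).
   Context: **Codes.** For a code $C\subseteq\Sigma^n$ (finite alphabet $\Sigma$), $\mathrm{dist}$ is the normalized Hamming distance, $\delta(C)=\min\{\mathrm{dist}(f,g):f\ne g\in C\}$ ($=+\infty$ if $|C|=1$) and $r(C)=\log_{|\Sigma^n|}|C|$. A tester (a randomized algorithm reading few letters of a word and accepting all codewords with probability 1) has soundness $\mu$ if $\mathrm{Prob}(\text{reject }f)\ge\mu\,\mathrm{dist}(f,C)$ for all $f\in\Sigma^n$. **Tensor codes.** $\mathbb{F}^A\otimes\mathbb{F}^B$ is identified with the matrices $\mathrm{M}_{A\times B}(\mathbb{F})$; $r_a(m)$ and $c_b(m)$ are the $a$-th row and $b$-th column of $m$. Thus $C_A\otimes C_B$ is the set of matrices all of whose rows lie in $C_B$ and all of whose columns lie in $C_A$. It is $\kappa$-agreement testable if for all $m_1\in C_A\otimes\mathbb{F}^B$ and $m_2\in\mathbb{F}^A\otimes C_B$ there is $m\in C_A\otimes C_B$ with $$\kappa\left[\tfrac{\#\{a\in A:r_a(m_2)\ne r_a(m)\}}{2|A|}+\tfrac{\#\{b\in B:c_b(m_1)\ne c_b(m)\}}{2|B|}\right]\le\tfrac{\#\{(a,b)\in A\times B:(m_1)_{a,b}\ne(m_2)_{a,b}\}}{|A||B|}.$$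 **Cayley graphs.** $\mathrm{Cay}(A,G)$ (resp. $\mathrm{Cay}(G,B)$) is the simple graph on $G$ with edges $\{g,ag\}$, $a\in A$ (resp. $\{g,gb\}$, $b\in B$). A $k$-regular graph is a $\lambda$-expander if all eigenvalues of its normalized adjacency operator ($\frac1k$ times the adjacency operator) on the space of real functions on vertices with sum $0$ are $\le\lambda$. **Relation to sheaves.** $Z^0$ is the space of $0$-cocycles $Z^0(X,\mathcal{F})$ of a sheaf on the square complex $X=\mathrm{Cay}(A,G,B)$ with vertices $\{g\}$, edges $\{g,ag\}$, $\{g,gb\}$, and squares $\{g,ag,gb,agb\}$. The natural weights on $X$ are $w(\{g\})=\frac1{|G|}$, $w(\{g,ag\})=\frac{1}{|A||G|}$, $w(\{g,gb\})=\frac{1}{|B||G|}$. An edge $\{g,ag\}$ is violated by $f\in\Sigma^G$ if $r_a(f(g))\ne r_{a^{-1}}(f(ag))$, and an edge $\{g,gb\}$ is violated if $c_b(f(g))\ne c_{b^{-1}}(f(gb))$. **Natural tester.** Given $f\in\Sigma^G$, choose an edge of $X$ uniformly at random, read the two values of $f$ at its endpoints, and accept iff the edge is not violated. **Correction Algorithm (parameter $q$).** Let $W(f)$ be the total weight $w$ of the edges violated by $f$. Start with $f_0=f$, $i=0$. While there are $g\in G$ and $m\in\Sigma$ such that the word $f'$ obtained from $f_i$ by adding $m$ to the value at $g$ satisfies $W(f')<W(f_i)-q/|G|$, choose such $g,m$, set $f_{i+1}=f'$ and increase $i$ by 1. Output the last $f_i$. *)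

theory Defs
  imports
    "HOL-Algebra.Generated_Groups"
    "HOL-Library.Extended_Real"
    "HOL-Library.FuncSet"
    "HOL-Probability.Probability_Mass_Function"
begin

section \<open>Codes\<close>

text \<open>
  Words over the alphabet \<open>S\<close> with coordinates in a finite set \<open>I\<close> are the elements of
  \<open>I \<rightarrow>\<^sub>E S\<close>.
\<close>

definition hdist :: "'i set \<Rightarrow> ('i \<Rightarrow> 's) \<Rightarrow> ('i \<Rightarrow> 's) \<Rightarrow> real" where
  "hdist I f g = real (card {i \<in> I. f i \<noteq> g i}) / real (card I)"

definition hdist_code :: "'i set \<Rightarrow> ('i \<Rightarrow> 's) \<Rightarrow> ('i \<Rightarrow> 's) set \<Rightarrow> real" where
  "hdist_code I f C = (INF g\<in>C. hdist I f g)"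

text \<open>The infimum is taken in \<^typ>\<open>ereal\<close>, so it is \<open>\<infinity>\<close> when \<open>C\<close> has only one word.\<close>

definition min_dist :: "'i set \<Rightarrow> ('i \<Rightarrow> 's) set \<Rightarrow> ereal" where
  "min_dist I C = (INF (f, g)\<in>{(f, g). f \<in> C \<and> g \<in> C \<and> f \<noteq> g}. ereal (hdist I f g))"

definition rate :: "'i set \<Rightarrow> 's set \<Rightarrow> ('i \<Rightarrow> 's) set \<Rightarrow> real" where
  "rate I S C = log (real (card (I \<rightarrow>\<^sub>E S))) (real (card C))"

definition linear_code :: "'i set \<Rightarrow> ('i \<Rightarrow> 'f::field) set \<Rightarrow> bool" where
  "linear_code I C \<longleftrightarrow>
     C \<subseteq> (I \<rightarrow>\<^sub>E UNIV) \<and>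
     (\<lambda>i\<in>I. 0) \<in> C \<and>
     (\<forall>u\<in>C. \<forall>v\<in>C. (\<lambda>i\<in>I. u i + v i) \<in> C) \<and>
     (\<forall>c. \<forall>u\<in>C. (\<lambda>i\<in>I. c * u i) \<in> C)"

section \<open>Testers\<close>

text \<open>
  A randomized non-adaptive tester is a distribution on pairs \<open>(Q, D)\<close>: the set \<open>Q\<close> of
  coordinates to be read, and the decision rule \<open>D\<close>, which only sees the restriction of the
  word to \<open>Q\<close>.
\<close>

type_synonym ('i, 's) tester = "('i set \<times> (('i \<Rightarrow> 's) \<Rightarrow> bool)) pmf"

definition reject_prob :: "('i, 's) tester \<Rightarrow> ('i \<Rightarrow> 's) \<Rightarrow> real" where
  "reject_prob T f = measure_pmf.prob T {(Q, D). \<not> D (restrict f Q)}"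

definition is_tester :: "nat \<Rightarrow> 'i set \<Rightarrow> ('i \<Rightarrow> 's) set \<Rightarrow> ('i, 's) tester \<Rightarrow> bool" where
  "is_tester q I C T \<longleftrightarrow>
     (\<forall>(Q, D)\<in>set_pmf T. Q \<subseteq> I \<and> finite Q \<and> card Q \<le> q) \<and>
     (\<forall>f\<in>C. measure_pmf.prob T {(Q, D). D (restrict f Q)} = 1)"

definition has_soundness ::
  "'i set \<Rightarrow> 's set \<Rightarrow> ('i \<Rightarrow> 's) set \<Rightarrow> ('i, 's) tester \<Rightarrow> real \<Rightarrow> bool" where
  "has_soundness I S C T \<mu> \<longleftrightarrow>
     (\<forall>f \<in> I \<rightarrow>\<^sub>E S. reject_prob T f \<ge> \<mu> * hdist_code I f C)"

section \<open>Tensor codes\<close>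

text \<open>\<open>A \<times> B\<close> matrices are the elements of \<open>(A \<times> B) \<rightarrow>\<^sub>E UNIV\<close>.\<close>

definition row :: "'b set \<Rightarrow> 'a \<Rightarrow> ('a \<times> 'b \<Rightarrow> 'f) \<Rightarrow> 'b \<Rightarrow> 'f" where
  "row B a m = (\<lambda>b\<in>B. m (a, b))"

definition col :: "'a set \<Rightarrow> 'b \<Rightarrow> ('a \<times> 'b \<Rightarrow> 'f) \<Rightarrow> 'a \<Rightarrow> 'f" where
  "col A b m = (\<lambda>a\<in>A. m (a, b))"

definition tensor_code ::
  "'a set \<Rightarrow> 'b set \<Rightarrow> ('a \<Rightarrow> 'f) set \<Rightarrow> ('b \<Rightarrow> 'f) set \<Rightarrow> ('a \<times> 'b \<Rightarrow> 'f) set" where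
  "tensor_code A B CA CB =
     {m \<in> (A \<times> B) \<rightarrow>\<^sub>E UNIV. (\<forall>a\<in>A. row B a m \<in> CB) \<and> (\<forall>b\<in>B. col A b m \<in> CA)}"

definition agreement_testable ::
  "'a set \<Rightarrow> 'b set \<Rightarrow> ('a \<Rightarrow> 'f) set \<Rightarrow> ('b \<Rightarrow> 'f) set \<Rightarrow> real \<Rightarrow> bool" where
  "agreement_testable A B CA CB \<kappa> \<longleftrightarrow>
     (\<forall>m1 \<in> tensor_code A B CA (B \<rightarrow>\<^sub>E UNIV). \<forall>m2 \<in> tensor_code A B (A \<rightarrow>\<^sub>E UNIV) CB.
       \<exists>m \<in> tensor_code A B CA CB.
         \<kappa> * (real (card {a \<in> A. row B a m2 \<noteq> row B a m}) / (2 * real (card A))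
              + real (card {b \<in> B. col A b m1 \<noteq> col A b m}) / (2 * real (card B)))
         \<le> real (card {(a, b). a \<in> A \<and> b \<in> B \<and> m1 (a, b) \<noteq> m2 (a, b)})
             / (real (card A) * real (card B)))"

section \<open>Expander graphs and Cayley graphs\<close>

text \<open>A simple graph is given by its vertex set and its set of edges, which are 2-element sets.\<close>

definition neighbours :: "'v set \<Rightarrow> 'v set set \<Rightarrow> 'v \<Rightarrow> 'v set" where
  "neighbours V E v = {u \<in> V. {v, u} \<in> E}"

definition regular_graph :: "'v set \<Rightarrow> 'v set set \<Rightarrow> nat \<Rightarrow> bool" where
  "regular_graph V E k \<longleftrightarrow> (\<forall>v\<in>V. card (neighbours V E v) = k)"

definition normalized_adjacency ::
  "'v set \<Rightarrow> 'v set set \<Rightarrow> nat \<Rightarrow> ('v \<Rightarrow> real) \<Rightarrow> 'v \<Rightarrow> real" where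
  "normalized_adjacency V E k f = (\<lambda>v\<in>V. 1 / real k * (\<Sum>u\<in>neighbours V E v. f u))"

definition sum_zero_eigenvalue :: "'v set \<Rightarrow> 'v set set \<Rightarrow> nat \<Rightarrow> real \<Rightarrow> bool" where
  "sum_zero_eigenvalue V E k \<mu> \<longleftrightarrow>
     (\<exists>f \<in> V \<rightarrow>\<^sub>E UNIV. (\<Sum>v\<in>V. f v) = 0 \<and> f \<noteq> (\<lambda>v\<in>V. 0) \<and>
        normalized_adjacency V E k f = (\<lambda>v\<in>V. \<mu> * f v))"

definition expander :: "'v set \<Rightarrow> 'v set set \<Rightarrow> real \<Rightarrow> bool" where
  "expander V E lam \<longleftrightarrow>
     (\<exists>k>0. regular_graph V E k \<and> (\<forall>\<mu>. sum_zero_eigenvalue V E k \<mu> \<longrightarrow> \<mu> \<le> lam))"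

definition cay_left_edges :: "('g, 'm) monoid_scheme \<Rightarrow> 'g set \<Rightarrow> 'g set set" where
  "cay_left_edges G A = {{g, a \<otimes>\<^bsub>G\<^esub> g} | g a. g \<in> carrier G \<and> a \<in> A}"

definition cay_right_edges :: "('g, 'm) monoid_scheme \<Rightarrow> 'g set \<Rightarrow> 'g set set" where
  "cay_right_edges G B = {{g, g \<otimes>\<^bsub>G\<^esub> b} | g b. g \<in> carrier G \<and> b \<in> B}"

section \<open>The square complex \<open>Cay(A,G,B)\<close>, its code and its tester\<close>

definition square_edges :: "('g, 'm) monoid_scheme \<Rightarrow> 'g set \<Rightarrow> 'g set \<Rightarrow> 'g set set" where
  "square_edges G A B = cay_left_edges G A \<union> cay_right_edges G B"

text \<open>
  The two kinds of edges are disjoint when no element of \<open>A\<close> is conjugate to an element of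
  \<open>B\<close>, so that the case distinction below is unambiguous.
\<close>

definition edge_weight ::
  "('g, 'm) monoid_scheme \<Rightarrow> 'g set \<Rightarrow> 'g set \<Rightarrow> 'g set \<Rightarrow> real" where
  "edge_weight G A B e =
     (if e \<in> cay_left_edges G A then 1 / (real (card A) * real (card (carrier G)))
      else 1 / (real (card B) * real (card (carrier G))))"

definition Z0 ::
  "('g, 'm) monoid_scheme \<Rightarrow> 'g set \<Rightarrow> 'g set \<Rightarrow> ('g \<times> 'g \<Rightarrow> 'f) set \<Rightarrow>
    ('g \<Rightarrow> 'g \<times> 'g \<Rightarrow> 'f) set" where
  "Z0 G A B S =
     {f \<in> carrier G \<rightarrow>\<^sub>E S. \<forall>a\<in>A. \<forall>b\<in>B. \<forall>g\<in>carrier G.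
        row B a (f g) = row B (inv\<^bsub>G\<^esub> a) (f (a \<otimes>\<^bsub>G\<^esub> g)) \<and>
        col A b (f g) = col A (inv\<^bsub>G\<^esub> b) (f (g \<otimes>\<^bsub>G\<^esub> b))}"

definition violated ::
  "('g, 'm) monoid_scheme \<Rightarrow> 'g set \<Rightarrow> 'g set \<Rightarrow> ('g \<Rightarrow> 'g \<times> 'g \<Rightarrow> 'f) \<Rightarrow> 'g set \<Rightarrow> bool" where
  "violated G A B f e \<longleftrightarrow>
     (\<exists>g\<in>carrier G. \<exists>a\<in>A. e = {g, a \<otimes>\<^bsub>G\<^esub> g} \<and>
        row B a (f g) \<noteq> row B (inv\<^bsub>G\<^esub> a) (f (a \<otimes>\<^bsub>G\<^esub> g))) \<or>
     (\<exists>g\<in>carrier G. \<exists>b\<in>B. e = {g, g \<otimes>\<^bsub>G\<^esub> b} \<and>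
        col A b (f g) \<noteq> col A (inv\<^bsub>G\<^esub> b) (f (g \<otimes>\<^bsub>G\<^esub> b)))"

definition natural_tester ::
  "('g, 'm) monoid_scheme \<Rightarrow> 'g set \<Rightarrow> 'g set \<Rightarrow> ('g, 'g \<times> 'g \<Rightarrow> 'f) tester" where
  "natural_tester G A B =
     map_pmf (\<lambda>e. (e, \<lambda>u. \<not> violated G A B u e)) (pmf_of_set (square_edges G A B))"

section \<open>The Correction Algorithm\<close>

definition violation_weight ::
  "('g, 'm) monoid_scheme \<Rightarrow> 'g set \<Rightarrow> 'g set \<Rightarrow> ('g \<Rightarrow> 'g \<times> 'g \<Rightarrow> 'f) \<Rightarrow> real" where
  "violation_weight G A B f =
     (\<Sum>e\<in>{e \<in> square_edges G A B. violated G A B f e}. edge_weight G A B e)"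

text \<open>
  The algorithm does not specify which admissible \<open>g\<close> and \<open>m\<close> is chosen, so one
  iteration of its loop is a relation between words.
\<close>

definition correction_step ::
  "('g, 'm) monoid_scheme \<Rightarrow> 'g set \<Rightarrow> 'g set \<Rightarrow> ('g \<times> 'g \<Rightarrow> 'f::field) set \<Rightarrow> real \<Rightarrow>
    ('g \<Rightarrow> 'g \<times> 'g \<Rightarrow> 'f) \<Rightarrow> ('g \<Rightarrow> 'g \<times> 'g \<Rightarrow> 'f) \<Rightarrow> bool" where
  "correction_step G A B S q f f' \<longleftrightarrow>
     (\<exists>g\<in>carrier G. \<exists>m\<in>S. f' = f(g := (\<lambda>p\<in>A \<times> B. f g p + m p)) \<and>
        violation_weight G A B f' < violation_weight G A B f - q / real (card (carrier G)))"

definition correction_output ::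
  "('g, 'm) monoid_scheme \<Rightarrow> 'g set \<Rightarrow> 'g set \<Rightarrow> ('g \<times> 'g \<Rightarrow> 'f::field) set \<Rightarrow> real \<Rightarrow>
    ('g \<Rightarrow> 'g \<times> 'g \<Rightarrow> 'f) \<Rightarrow> ('g \<Rightarrow> 'g \<times> 'g \<Rightarrow> 'f) \<Rightarrow> bool" where
  "correction_output G A B S q f h \<longleftrightarrow>
     (correction_step G A B S q)\<^sup>*\<^sup>* f h \<and> \<not> (\<exists>h'. correction_step G A B S q h h')"

definition correction_terminates ::
  "('g, 'm) monoid_scheme \<Rightarrow> 'g set \<Rightarrow> 'g set \<Rightarrow> ('g \<times> 'g \<Rightarrow> 'f::field) set \<Rightarrow> real \<Rightarrow>
    ('g \<Rightarrow> 'g \<times> 'g \<Rightarrow> 'f) \<Rightarrow> bool" where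
  "correction_terminates G A B S q f \<longleftrightarrow>
     \<not> (\<exists>s. s 0 = f \<and> (\<forall>i::nat. correction_step G A B S q (s i) (s (Suc i))))"

text \<open>Every run on a word that is \<open>\<eta>\<close>-close to the code ends with the unique nearby codeword.\<close>

definition correction_decodes ::
  "('g, 'm) monoid_scheme \<Rightarrow> 'g set \<Rightarrow> 'g set \<Rightarrow> ('g \<times> 'g \<Rightarrow> 'f::field) set \<Rightarrow> real \<Rightarrow> real \<Rightarrow>
    bool" where
  "correction_decodes G A B S q \<eta> \<longleftrightarrow>
     (\<forall>f \<in> carrier G \<rightarrow>\<^sub>E S. hdist_code (carrier G) f (Z0 G A B S) < \<eta> \<longrightarrow>
        (\<exists>!h. h \<in> Z0 G A B S \<and> hdist (carrier G) f h < \<eta>) \<and>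
        correction_terminates G A B S q f \<and>
        (\<forall>h. correction_output G A B S q f h \<longrightarrow>
           h \<in> Z0 G A B S \<and> hdist (carrier G) f h < \<eta>))"

end

(*
  Let the load of a vertex be the fraction of left edges plus the
  fraction of right edges at it that a word violates. If no change at one vertex lowers the violated
  weight noticeably, agreement testability at a vertex g, applied to the rows and columns that its
  neighbours prescribe, bounds the load of g by the violations on the edges opposite to g in the
  squares around it. Expansion makes this impossible for the heavily loaded vertices of a word with
  small violated weight. On the other hand, a violated edge with lightly loaded ends needs violated
  parallel edges in many squares, because the component codes have large distance, and expansion
  in the other direction shows that such edges are rare. Hence a word of small weight on which the
  Correction Algorithm is stuck is a codeword, which gives both decoding and soundness.

  Codewords are labellings of the squares whose local views lie in the tensor code, and counting
  these gives the rate. The minimum distance is the expansion of the support of a difference.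
*)
theory Submission
  imports Defs
begin

section \<open>The quadratic form of an expander\<close>

text \<open>The hypothesis \<open>expander\<close> speaks only of eigenvalues, and bounds them only
  from above, so expansion first has to become an inequality for a quadratic form: the maximum of
  the form over mean-zero unit functions is itself an eigenvalue. The squares then link the two
  graphs. The parallel edges {g, ag} and {gb, agb} carry the same label a, so for fixed a the
  violated left edges form a subset of G, and expansion of Cay(G,B) applies to it. This needs the
  subset to be small, while a bound on the total weight controls a single label only up to the
  factor |A|. That is the origin of the term with max{|A|,|B|} in 1/\<eta>. The powers of \<epsilon>
  come from the heavy vertices. If r is the mean load, the vertices of load at least \<epsilon>/20
  have density O(r/\<epsilon>). Mixing gives a main term (r/\<epsilon>)^2 and an error
  \<lambda>r/\<epsilon>, and both must stay below a small multiple of \<epsilon>r. This asks for r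
  of order \<epsilon>^3 and \<lambda> of order \<epsilon>^2.\<close>

lemma compact_PiE_UNIV:
  fixes X :: "'i \<Rightarrow> 'b::topological_space set"
  assumes "\<And>i. compact (X i)"
  shows "compact (PiE UNIV X)"
proof -
  have "compactin (product_topology (\<lambda>i. euclidean) UNIV) (PiE UNIV X)"
    using assms by (simp add: compactin_PiE)
  thus ?thesis by (simp add: euclidean_product_topology)
qed

text \<open>The mean-zero functions of norm one form a compact set on which the form is continuous;
  homogeneity extends the bound from this sphere to all mean-zero functions. The witness
  \<open>h0\<close> makes the sphere nonempty, which fails for a single vertex.\<close>

lemma max_rayleigh_quotient:
  fixes K :: "'v \<Rightarrow> 'v \<Rightarrow> real" and h0 :: "'v \<Rightarrow> real"
  assumes fin: "finite V"
    and h0: "(\<Sum>v\<in>V. h0 v) = 0" "v0 \<in> V" "h0 v0 \<noteq> 0"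
  obtains f \<mu> where "\<And>v. v \<notin> V \<Longrightarrow> f v = 0" "(\<Sum>v\<in>V. f v) = 0" "(\<Sum>v\<in>V. (f v)\<^sup>2) = 1"
    "\<mu> = (\<Sum>v\<in>V. f v * (\<Sum>u\<in>V. K v u * f u))"
    "\<And>h. (\<Sum>v\<in>V. h v) = 0 \<Longrightarrow>
      (\<Sum>v\<in>V. h v * (\<Sum>u\<in>V. K v u * h u)) \<le> \<mu> * (\<Sum>v\<in>V. (h v)\<^sup>2)"
proof -
  define Q where "Q h = (\<Sum>v\<in>V. h v * (\<Sum>u\<in>V. K v u * h u))" for h
  \<comment> \<open>The vertex type may be infinite, so functions are pinned to 0 off
    \<open>V\<close>. The box supplies compactness and loses nothing, since the entries of a unit
    vector are at most 1 in absolute value.\<close>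
  define X where "X = PiE UNIV (\<lambda>v. if v \<in> V then {-1..1::real} else {0})"
  define T where "T = X \<inter> ({f. (\<Sum>v\<in>V. f v) = 0} \<inter> {f. (\<Sum>v\<in>V. (f v)\<^sup>2) = 1})"
  define nrm where "nrm h = (\<lambda>v. if v \<in> V then h v / sqrt (\<Sum>v\<in>V. (h v)\<^sup>2) else 0)" for h
  have cont: "continuous_on S (\<lambda>f::'v \<Rightarrow> real. f v)" for S v
    by (rule continuous_on_subset[OF continuous_on_product_coordinates]) simp
  have "continuous_on UNIV (\<lambda>f::'v \<Rightarrow> real. \<Sum>v\<in>V. f v)"
    by (rule continuous_on_sum, rule cont)
  hence "closed {f::'v \<Rightarrow> real. (\<Sum>v\<in>V. f v) = 0}"
    using closed_Collect_eq continuous_on_const by blast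
  moreover have "continuous_on UNIV (\<lambda>f::'v \<Rightarrow> real. \<Sum>v\<in>V. (f v)\<^sup>2)"
    by (rule continuous_on_sum, rule continuous_on_power, rule cont)
  hence "closed {f::'v \<Rightarrow> real. (\<Sum>v\<in>V. (f v)\<^sup>2) = 1}"
    using closed_Collect_eq continuous_on_const by blast
  ultimately have comp: "compact T"
    unfolding T_def X_def by (intro compact_Int_closed compact_PiE_UNIV closed_Int) auto
  have pos: "(\<Sum>v\<in>V. (h v)\<^sup>2) > 0" if "v \<in> V" "h v \<noteq> 0" for h :: "'v \<Rightarrow> real" and v
    by (rule sum_pos2[OF fin that(1)]) (use that in auto)
  have nrmT: "nrm h \<in> T" if h: "(\<Sum>v\<in>V. h v) = 0" and v: "v \<in> V" "h v \<noteq> 0" for h v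
  proof -
    define s where "s = (\<Sum>v\<in>V. (h v)\<^sup>2)"
    have s: "s > 0" unfolding s_def by (rule pos[of v h, OF v])
    have "\<bar>h u\<bar> \<le> sqrt s" if "u \<in> V" for u
      using member_le_sum[of u V "\<lambda>v. (h v)\<^sup>2"] that fin by (simp add: s_def real_le_rsqrt)
    hence "h u \<le> sqrt s" "- sqrt s \<le> h u" if "u \<in> V" for u
      using that by (force simp: abs_le_iff)+
    moreover have "(\<Sum>v\<in>V. (h v / sqrt s)\<^sup>2) = 1"
      using s by (simp add: power_divide s_def[symmetric] sum_divide_distrib[symmetric])
    moreover have "(\<Sum>v\<in>V. h v / sqrt s) = 0"
      using h by (simp add: sum_divide_distrib[symmetric])
    ultimately show ?thesis
      using s unfolding T_def X_def nrm_def s_def[symmetric]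
      by (auto simp: divide_le_eq le_divide_eq)
  qed
  have "T \<noteq> {}" using nrmT[OF h0] by auto
  moreover have "continuous_on T Q"
    unfolding Q_def
    by (rule continuous_on_sum, rule continuous_on_mult[OF cont], rule continuous_on_sum,
        rule continuous_on_mult[OF continuous_on_const cont])
  ultimately obtain f where f: "f \<in> T" "\<And>h. h \<in> T \<Longrightarrow> Q h \<le> Q f"
    using continuous_attains_sup[OF comp] by blast
  have "Q h \<le> Q f * (\<Sum>v\<in>V. (h v)\<^sup>2)" if h: "(\<Sum>v\<in>V. h v) = 0" for h
  proof (cases "\<exists>v\<in>V. h v \<noteq> 0")
    case True
    then obtain v where v: "v \<in> V" "h v \<noteq> 0" by blast
    define s where "s = (\<Sum>v\<in>V. (h v)\<^sup>2)"
    have s: "s > 0" unfolding s_def by (rule pos[of v h, OF v])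
    have "Q (nrm h) = (\<Sum>v\<in>V. h v / sqrt s * (\<Sum>u\<in>V. K v u * (h u / sqrt s)))"
      unfolding Q_def nrm_def s_def by (intro sum.cong refl arg_cong2[where f="(*)"]) auto
    also have "\<dots> = (\<Sum>v\<in>V. h v * (\<Sum>u\<in>V. K v u * h u) / s)"
      using s by (intro sum.cong refl) (simp add: sum_divide_distrib[symmetric] real_div_sqrt field_simps)
    finally have "Q (nrm h) = Q h / s" by (simp add: Q_def sum_divide_distrib[symmetric])
    with f(2)[OF nrmT[OF h v]] s show ?thesis by (simp add: s_def[symmetric] field_simps)
  qed (simp add: Q_def)
  thus ?thesis
    using f(1) by (intro that[of f "Q f"]) (auto simp: T_def X_def Q_def PiE_iff split: if_splits)
qed

text \<open>First variation in the direction of the residual \<open>r\<close> itself: along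
  \<open>f + t * r\<close> the form exceeds its bound by \<open>2 * t * s\<close> to first order,
  where \<open>s\<close> is the squared norm of \<open>r\<close>. Maximality therefore forces
  \<open>s = 0\<close>.\<close>

lemma max_rayleigh_eigenfunction:
  fixes K :: "'v \<Rightarrow> 'v \<Rightarrow> real"
  assumes fin: "finite V"
    and sym: "\<And>u v. u \<in> V \<Longrightarrow> v \<in> V \<Longrightarrow> K u v = K v u"
    and stoch: "\<And>v. v \<in> V \<Longrightarrow> (\<Sum>u\<in>V. K v u) = 1"
    and f0: "(\<Sum>v\<in>V. f v) = 0" and f1: "(\<Sum>v\<in>V. (f v)\<^sup>2) = 1"
    and \<mu>: "\<mu> = (\<Sum>v\<in>V. f v * (\<Sum>u\<in>V. K v u * f u))"
    and max: "\<And>h. (\<Sum>v\<in>V. h v) = 0 \<Longrightarrow>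
      (\<Sum>v\<in>V. h v * (\<Sum>u\<in>V. K v u * h u)) \<le> \<mu> * (\<Sum>v\<in>V. (h v)\<^sup>2)"
    and v: "v \<in> V"
  shows "(\<Sum>u\<in>V. K v u * f u) = \<mu> * f v"
proof -
  define N where "N f = (\<lambda>v. \<Sum>u\<in>V. K v u * f u)" for f
  define r where "r = (\<lambda>v. N f v - \<mu> * f v)"
  define s where "s = (\<Sum>v\<in>V. (r v)\<^sup>2)"
  define R where "R = \<mu> * s - (\<Sum>v\<in>V. r v * N r v)"
  have self_adj: "(\<Sum>v\<in>V. g v * N h v) = (\<Sum>v\<in>V. h v * N g v)" for g h
  proof -
    have "(\<Sum>v\<in>V. g v * N h v) = (\<Sum>v\<in>V. \<Sum>u\<in>V. g v * K v u * h u)"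
      by (simp add: N_def sum_distrib_left mult.assoc)
    also have "\<dots> = (\<Sum>u\<in>V. \<Sum>v\<in>V. g v * K v u * h u)" by (rule sum.swap)
    also have "\<dots> = (\<Sum>v\<in>V. h v * N g v)"
      by (auto simp: N_def sum_distrib_left sym intro!: sum.cong)
    finally show ?thesis .
  qed
  \<comment> \<open>By symmetry the columns also sum to 1, so \<open>N\<close> preserves sums and
    \<open>r\<close> is an admissible direction.\<close>
  have "(\<Sum>v\<in>V. N f v) = (\<Sum>v\<in>V. 1 * N f v)" by simp
  also have "\<dots> = (\<Sum>v\<in>V. f v * N (\<lambda>_. 1) v)" by (rule self_adj)
  also have "\<dots> = (\<Sum>v\<in>V. f v)" by (intro sum.cong refl) (simp add: N_def stoch)
  finally have sumr: "(\<Sum>v\<in>V. r v) = 0"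
    by (simp add: r_def sum_subtractf sum_distrib_left[symmetric] f0)
  have key: "2 * t * s \<le> t\<^sup>2 * R" for t
  proof -
    have "(\<Sum>v\<in>V. f v + t * r v) = 0"
      by (simp add: sum.distrib sum_distrib_left[symmetric] f0 sumr)
    hence le: "(\<Sum>v\<in>V. (f v + t * r v) * N (\<lambda>v. f v + t * r v) v) \<le> \<mu> * (\<Sum>v\<in>V. (f v + t * r v)\<^sup>2)"
      unfolding N_def by (rule max)
    have N: "N (\<lambda>v. f v + t * r v) v = N f v + t * N r v" for v
      by (simp add: N_def algebra_simps sum.distrib sum_distrib_left)
    have "(\<Sum>v\<in>V. (f v + t * r v) * N (\<lambda>v. f v + t * r v) v)
        = (\<Sum>v\<in>V. f v * N f v) + t * (\<Sum>v\<in>V. f v * N r v) + t * (\<Sum>v\<in>V. r v * N f v)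
          + t\<^sup>2 * (\<Sum>v\<in>V. r v * N r v)"
      by (simp add: N algebra_simps sum.distrib sum_distrib_left power2_eq_square)
    also have "\<dots> = \<mu> + 2 * t * (\<Sum>v\<in>V. r v * N f v) + t\<^sup>2 * (\<Sum>v\<in>V. r v * N r v)"
      using \<mu> self_adj[of f r] by (simp add: N_def)
    finally have 1: "(\<Sum>v\<in>V. (f v + t * r v) * N (\<lambda>v. f v + t * r v) v) = \<dots>" .
    have 2: "(\<Sum>v\<in>V. (f v + t * r v)\<^sup>2) = 1 + 2 * t * (\<Sum>v\<in>V. r v * f v) + t\<^sup>2 * s"
      using f1 by (simp add: s_def power2_sum power_mult_distrib sum.distrib sum_distrib_left algebra_simps)
    have "s = (\<Sum>v\<in>V. r v * N f v) - \<mu> * (\<Sum>v\<in>V. r v * f v)"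
      unfolding s_def by (simp add: sum_distrib_left sum_subtractf[symmetric] power2_eq_square)
         (auto simp: r_def algebra_simps intro!: sum.cong)
    hence "2 * t * (\<Sum>v\<in>V. r v * N f v) = 2 * t * (s + \<mu> * (\<Sum>v\<in>V. r v * f v))"
      by simp
    with le show ?thesis unfolding 1 2 R_def by (simp add: algebra_simps)
  qed
  have "s \<ge> 0" unfolding s_def by (intro sum_nonneg) auto
  moreover have "\<not> s > 0"
  proof
    assume s: "s > 0"
    \<comment> \<open>\<open>t = 1\<close> makes \<open>R\<close> positive; then
      \<open>t = s / R\<close> would give 2s^2/R at most s^2/R.\<close>
    from key[of 1] s have R: "R > 0" by simp
    from key[of "s / R"] R s show False by (simp add: power2_eq_square field_simps)
  qed
  ultimately have "s = 0" by simp
  with v fin have "r v = 0" by (simp add: s_def sum_nonneg_eq_0_iff)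
  thus ?thesis by (simp add: r_def N_def)
qed

text \<open>Subtracting the mean \<open>c\<close> leaves a mean-zero part \<open>h\<close>. The
  cross terms vanish, the constant part yields the first summand, and the maximum of the form over
  mean-zero unit functions is an eigenvalue, to which \<open>eig\<close> applies.
  \<open>lam \<ge> 0\<close> allows the squares of \<open>h\<close> to be replaced by those of
  \<open>F\<close>.\<close>

lemma expander_quadratic_form:
  fixes F :: "'v \<Rightarrow> real"
  assumes fin: "finite V" and reg: "regular_graph V E k" and k: "k > 0"
    and eig: "\<And>\<mu>. sum_zero_eigenvalue V E k \<mu> \<Longrightarrow> \<mu> \<le> lam" and lam: "lam \<ge> 0"
  shows "(\<Sum>v\<in>V. F v * (1 / real k * (\<Sum>u\<in>neighbours V E v. F u)))
    \<le> (\<Sum>v\<in>V. F v)\<^sup>2 / real (card V) + lam * (\<Sum>v\<in>V. (F v)\<^sup>2)"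
proof (cases "V = {}")
  case False
  define K where "K v u = (if {v, u} \<in> E then 1 / real k else 0)" for v u
  have K: "1 / real k * (\<Sum>u\<in>neighbours V E v. f u) = (\<Sum>u\<in>V. K v u * f u)" for f v
    unfolding K_def neighbours_def
    by (simp add: sum_divide_distrib sum.inter_filter fin if_distrib[of "\<lambda>x. x * _"]
        if_distrib[of "\<lambda>x. x / _"] cong: if_cong)
  have sym: "K u v = K v u" for u v by (simp add: K_def insert_commute)
  have stoch: "(\<Sum>u\<in>V. K v u) = 1" if "v \<in> V" for v
    using K[where f="\<lambda>_. 1" and v=v] reg k that by (simp add: regular_graph_def)
  define n where "n = real (card V)"
  have n: "n > 0" using False fin by (simp add: n_def card_gt_0_iff)
  define c where "c = (\<Sum>v\<in>V. F v) / n"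
  define h where "h v = F v - c" for v
  have h0: "(\<Sum>v\<in>V. h v) = 0" using n by (simp add: h_def sum_subtractf c_def n_def[symmetric])
  have h_le: "(\<Sum>v\<in>V. h v * (\<Sum>u\<in>V. K v u * h u)) \<le> lam * (\<Sum>v\<in>V. (h v)\<^sup>2)"
  \<comment> \<open>If \<open>h\<close> vanishes on \<open>V\<close>, there may be no mean-zero
    eigenfunction at all, but both sides are then 0.\<close>
  proof (cases "\<exists>v\<in>V. h v \<noteq> 0")
    case True
    then obtain v0 where v0: "v0 \<in> V" "h v0 \<noteq> 0" by blast
    obtain f \<mu> where f: "\<And>v. v \<notin> V \<Longrightarrow> f v = 0" "(\<Sum>v\<in>V. f v) = 0" "(\<Sum>v\<in>V. (f v)\<^sup>2) = 1"
      "\<mu> = (\<Sum>v\<in>V. f v * (\<Sum>u\<in>V. K v u * f u))"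
      "\<And>h. (\<Sum>v\<in>V. h v) = 0 \<Longrightarrow>
        (\<Sum>v\<in>V. h v * (\<Sum>u\<in>V. K v u * h u)) \<le> \<mu> * (\<Sum>v\<in>V. (h v)\<^sup>2)"
      by (rule max_rayleigh_quotient[OF fin h0 v0, of K]) (rule that)
    have "sum_zero_eigenvalue V E k \<mu>"
      unfolding sum_zero_eigenvalue_def
    proof (intro bexI conjI)
      show "(\<Sum>v\<in>V. restrict f V v) = 0" using f(2) by simp
      show "restrict f V \<noteq> (\<lambda>v\<in>V. 0)"
      proof
        assume *: "restrict f V = (\<lambda>v\<in>V. 0)"
        have "f v = 0" if "v \<in> V" for v using fun_cong[OF *, of v] that by simp
        with f(3) show False by simp
      qed
      show "normalized_adjacency V E k (restrict f V) = (\<lambda>v\<in>V. \<mu> * restrict f V v)"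
        unfolding normalized_adjacency_def K
        using max_rayleigh_eigenfunction[of V K f \<mu>] fin sym stoch f by (auto intro!: restrict_ext)
    qed auto
    hence "\<mu> \<le> lam" by (rule eig)
    hence "\<mu> * (\<Sum>v\<in>V. (h v)\<^sup>2) \<le> lam * (\<Sum>v\<in>V. (h v)\<^sup>2)"
      by (intro mult_right_mono sum_nonneg) auto
    with f(5)[OF h0] show ?thesis by linarith
  qed simp
  have Kh: "(\<Sum>v\<in>V. \<Sum>u\<in>V. K v u * h u) = 0"
  proof -
    have "(\<Sum>v\<in>V. \<Sum>u\<in>V. K v u * h u) = (\<Sum>u\<in>V. \<Sum>v\<in>V. K v u * h u)" by (rule sum.swap)
    also have "\<dots> = (\<Sum>u\<in>V. h u)"
      by (intro sum.cong refl, subst sym) (simp add: sum_distrib_right[symmetric] stoch)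
    finally show ?thesis using h0 by simp
  qed
  have "(\<Sum>v\<in>V. F v * (\<Sum>u\<in>V. K v u * F u)) = (\<Sum>v\<in>V. (h v + c) * ((\<Sum>u\<in>V. K v u * h u) + c))"
  proof (intro sum.cong refl)
    fix v assume v: "v \<in> V"
    have "(\<Sum>u\<in>V. K v u * F u) = (\<Sum>u\<in>V. K v u * h u + c * K v u)"
      by (intro sum.cong refl) (simp add: h_def algebra_simps)
    also have "\<dots> = (\<Sum>u\<in>V. K v u * h u) + c"
      using stoch[OF v] by (simp add: sum.distrib sum_distrib_left[symmetric])
    finally show "F v * (\<Sum>u\<in>V. K v u * F u) = (h v + c) * ((\<Sum>u\<in>V. K v u * h u) + c)"
      by (simp add: h_def)
  qed
  also have "\<dots> = (\<Sum>v\<in>V. h v * (\<Sum>u\<in>V. K v u * h u)) + c * (\<Sum>v\<in>V. \<Sum>u\<in>V. K v u * h u)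
      + c * (\<Sum>v\<in>V. h v) + n * c\<^sup>2"
    by (simp only: distrib_left distrib_right sum.distrib sum_distrib_left n_def)
       (simp add: power2_eq_square mult.commute)
  also have "\<dots> \<le> lam * (\<Sum>v\<in>V. (h v)\<^sup>2) + n * c\<^sup>2"
    using h_le h0 Kh by simp
  also have "n * c\<^sup>2 = (\<Sum>v\<in>V. F v)\<^sup>2 / n" using n by (simp add: c_def power2_eq_square)
  also have "(\<Sum>v\<in>V. (h v)\<^sup>2) \<le> (\<Sum>v\<in>V. (F v)\<^sup>2)"
  proof -
    have "(\<Sum>v\<in>V. (F v)\<^sup>2) = (\<Sum>v\<in>V. (h v)\<^sup>2 + 2 * c * h v + c\<^sup>2)"
      by (intro sum.cong refl) (simp add: h_def power2_eq_square algebra_simps)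
    also have "\<dots> = (\<Sum>v\<in>V. (h v)\<^sup>2) + n * c\<^sup>2"
      using h0 by (simp add: sum.distrib sum_distrib_left[symmetric] n_def)
    finally show ?thesis using n by simp
  qed
  finally show ?thesis using lam unfolding K n_def by (simp add: mult_left_mono)
qed simp

section \<open>Bad edges in labelled graphs\<close>

text \<open>The common shape of the two Cayley graphs: \<open>s a v\<close> is the neighbour of
  \<open>v\<close> along label \<open>a\<close>, and \<open>i a\<close> is the label of the same
  edge seen from the other end. Each argument is thus made once and used for left and right
  multiplication.\<close>

locale labelled_graph =
  fixes V :: "'v set" and A :: "'a set" and s :: "'a \<Rightarrow> 'v \<Rightarrow> 'v" and i :: "'a \<Rightarrow> 'a"
  assumes fin_V: "finite V" and V_ne: "V \<noteq> {}" and fin_A: "finite A" and A_ne: "A \<noteq> {}"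
    and s_closed: "a \<in> A \<Longrightarrow> v \<in> V \<Longrightarrow> s a v \<in> V"
    and i_closed: "a \<in> A \<Longrightarrow> i a \<in> A"
    and s_i: "a \<in> A \<Longrightarrow> v \<in> V \<Longrightarrow> s (i a) (s a v) = v"
    and i_i: "a \<in> A \<Longrightarrow> i (i a) = a"
begin

lemma card_A_pos: "real (card A) > 0"
  using fin_A A_ne by (simp add: card_gt_0_iff)

lemma card_V_pos: "real (card V) > 0"
  using fin_V V_ne by (simp add: card_gt_0_iff)

text \<open>Reversal \<open>(v, a) \<mapsto> (s a v, i a)\<close> is an involution on directed
  edges.\<close>

lemma sum_reverse_edges:
  "(\<Sum>v\<in>V. \<Sum>a\<in>A. h v a) = (\<Sum>v\<in>V. \<Sum>a\<in>A. h (s a v) (i a))"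
  unfolding sum.cartesian_product
  by (rule sum.reindex_bij_witness[where i="\<lambda>(v, a). (s a v, i a)" and j="\<lambda>(v, a). (s a v, i a)"])
     (auto simp: s_closed i_closed s_i i_i)

definition avg :: "('v \<Rightarrow> real) \<Rightarrow> 'v \<Rightarrow> real" where
  "avg f v = (\<Sum>a\<in>A. f (s a v)) / real (card A)"

lemma avg_self_adjoint: "(\<Sum>v\<in>V. f v * avg g v) = (\<Sum>v\<in>V. g v * avg f v)"
proof -
  have "(\<Sum>v\<in>V. \<Sum>a\<in>A. f v * g (s a v)) = (\<Sum>v\<in>V. \<Sum>a\<in>A. g v * f (s a v))"
    by (subst sum_reverse_edges) (auto simp: s_i mult.commute intro!: sum.cong)
  thus ?thesis
    by (simp add: avg_def sum_distrib_left sum_divide_distrib[symmetric])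
qed

end

locale expanding_graph = labelled_graph +
  fixes lam :: real
  assumes lam_nonneg: "lam \<ge> 0"
    and mixing: "(\<Sum>v\<in>V. f v * avg f v) \<le> (\<Sum>v\<in>V. f v)\<^sup>2 / real (card V) + lam * (\<Sum>v\<in>V. (f v)\<^sup>2)"
begin

text \<open>
  Only the positive part of the spectrum is controlled, so the bilinear form is bounded through
  the quadratic form at \<open>f + g\<close>, whose diagonal terms are nonnegative and can be dropped.
\<close>

lemma bilinear_mixing:
  assumes f: "\<And>v. v \<in> V \<Longrightarrow> f v \<ge> 0" and g: "\<And>v. v \<in> V \<Longrightarrow> g v \<ge> 0"
  shows "2 * (\<Sum>v\<in>V. f v * avg g v)
    \<le> (\<Sum>v\<in>V. f v + g v)\<^sup>2 / real (card V) + lam * (\<Sum>v\<in>V. (f v + g v)\<^sup>2)"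
proof -
  have avg_nonneg: "avg h v \<ge> 0" if "\<And>v. v \<in> V \<Longrightarrow> h v \<ge> 0" "v \<in> V" for h v
    unfolding avg_def using that s_closed by (intro divide_nonneg_nonneg sum_nonneg) auto
  have "avg (\<lambda>v. f v + g v) v = avg f v + avg g v" for v
    by (simp add: avg_def sum.distrib add_divide_distrib)
  hence "(\<Sum>v\<in>V. (f v + g v) * avg (\<lambda>v. f v + g v) v)
      = (\<Sum>v\<in>V. f v * avg f v) + (\<Sum>v\<in>V. f v * avg g v)
        + (\<Sum>v\<in>V. g v * avg f v) + (\<Sum>v\<in>V. g v * avg g v)"
    by (simp add: algebra_simps sum.distrib)
  moreover have "(\<Sum>v\<in>V. f v * avg f v) \<ge> 0" "(\<Sum>v\<in>V. g v * avg g v) \<ge> 0"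
    by (intro sum_nonneg mult_nonneg_nonneg f g avg_nonneg; assumption)+
  ultimately show ?thesis
    using mixing[of "\<lambda>v. f v + g v"] avg_self_adjoint[of f g] by linarith
qed

text \<open>The case of an indicator function in \<open>mixing\<close>: the left side sums, over the
  points of \<open>X\<close>, the fraction of neighbours that stay in \<open>X\<close>. It serves
  twice, for the violated edges of one label and for the support of a difference of
  codewords.\<close>

lemma small_set_avg:
  assumes "X \<subseteq> V" and "real (card X) \<le> \<xi> * real (card V)"
  shows "(\<Sum>v\<in>V. of_bool (v \<in> X) * avg (\<lambda>v. of_bool (v \<in> X)) v) \<le> (\<xi> + lam) * real (card X)"
proof -
  have X: "(\<Sum>v\<in>V. of_bool (v \<in> X)) = real (card X)"
    using assms(1) fin_V by (simp add: Int_absorb1 Int_commute)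
  have "(\<Sum>v\<in>V. of_bool (v \<in> X) * avg (\<lambda>v. of_bool (v \<in> X)) v)
      \<le> (real (card X))\<^sup>2 / real (card V) + lam * real (card X)"
    using mixing[of "\<lambda>v. of_bool (v \<in> X)"] X by (simp add: power2_eq_square flip: of_bool_conj)
  also have "(real (card X))\<^sup>2 / real (card V) \<le> \<xi> * real (card X)"
    using mult_right_mono[OF assms(2), of "real (card X)"] card_V_pos
    by (simp add: divide_le_eq power2_eq_square algebra_simps)
  finally show ?thesis by (simp add: algebra_simps)
qed

end

definition edge_fraction :: "'a set \<Rightarrow> ('v \<Rightarrow> 'a \<Rightarrow> bool) \<Rightarrow> 'v \<Rightarrow> real" where
  "edge_fraction A P v = real (card {a \<in> A. P v a}) / real (card A)"

lemma edge_fraction_bounds: "0 \<le> edge_fraction A P v" "edge_fraction A P v \<le> 1"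
proof -
  show "edge_fraction A P v \<le> 1"
  proof (cases "finite A")
    case True
    hence "card {a \<in> A. P v a} \<le> card A" by (intro card_mono) auto
    thus ?thesis by (auto simp: edge_fraction_def divide_le_eq)
  qed (simp add: edge_fraction_def)
qed (simp add: edge_fraction_def)

lemma edge_fraction_altdef:
  "finite A \<Longrightarrow> edge_fraction A P v = (\<Sum>a\<in>A. of_bool (P v a)) / real (card A)"
  by (simp add: edge_fraction_def Int_def)

text \<open>
  A bad edge whose two ends have few bad edges forces many of the parallel edges to be bad, so
  expansion along the second direction shows that there are few such edges.
\<close>

lemma bad_edges_meet_heavy_vertices:
  fixes s :: "'a \<Rightarrow> 'v \<Rightarrow> 'v" and t :: "'b \<Rightarrow> 'v \<Rightarrow> 'v" and P :: "'v \<Rightarrow> 'a \<Rightarrow> bool"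
  assumes "labelled_graph V A s i" and "expanding_graph V B t j lam"
    and sym: "\<And>v a. v \<in> V \<Longrightarrow> a \<in> A \<Longrightarrow> P (s a v) (i a) = P v a"
    and opp: "\<And>v a. v \<in> V \<Longrightarrow> a \<in> A \<Longrightarrow> P v a \<Longrightarrow>
      \<epsilon> \<le> edge_fraction B (\<lambda>v b. P (t b v) a) v + w v + w (s a v)"
    and small: "\<And>a. a \<in> A \<Longrightarrow> real (card {v \<in> V. P v a}) \<le> \<xi> * real (card V)"
    and \<theta>: "2 * \<theta> < \<epsilon>" and \<xi>: "\<xi> + lam \<le> (\<epsilon> - 2 * \<theta>) / 100"
  shows "0.99 * (\<Sum>v\<in>V. edge_fraction A P v)
    \<le> 2 * (\<Sum>v\<in>V. of_bool (\<theta> \<le> w v) * edge_fraction A P v)"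
proof -
  interpret A: labelled_graph V A s i by fact
  interpret B: expanding_graph V B t j lam by fact
  define p :: "'v \<Rightarrow> 'a \<Rightarrow> real" where "p v a = of_bool (P v a)" for v a
  define l :: "'v \<Rightarrow> 'a \<Rightarrow> real" where "l v a = of_bool (P v a \<and> w v < \<theta> \<and> w (s a v) < \<theta>)" for v a
  define N where "N = (\<Sum>v\<in>V. \<Sum>a\<in>A. p v a)"
  define L where "L = (\<Sum>v\<in>V. \<Sum>a\<in>A. l v a)"
  define H where "H = (\<Sum>v\<in>V. \<Sum>a\<in>A. of_bool (\<theta> \<le> w v) * p v a)"
  have frac_B: "edge_fraction B (\<lambda>v b. P (t b v) a) v = B.avg (\<lambda>v. p v a) v" for v a
    by (simp add: edge_fraction_altdef B.fin_A B.avg_def p_def del: sum_of_bool_eq)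
  \<comment> \<open>If both ends have \<open>w\<close> below \<open>\<theta>\<close>, then
    \<open>opp\<close> leaves at least a fraction \<open>\<epsilon> - 2 * \<theta>\<close> of bad
    parallel edges.\<close>
  have light: "(\<epsilon> - 2 * \<theta>) * l v a \<le> p v a * B.avg (\<lambda>v. p v a) v" if "v \<in> V" "a \<in> A" for v a
  proof (cases "P v a \<and> w v < \<theta> \<and> w (s a v) < \<theta>")
    case True
    thus ?thesis using opp[OF that] by (simp add: l_def p_def[of v] frac_B)
  next
    case False
    have "B.avg (\<lambda>v. p v a) v \<ge> 0"
      unfolding B.avg_def by (intro divide_nonneg_nonneg sum_nonneg) (auto simp: p_def)
    moreover have "l v a = 0" "p v a \<ge> 0" using False by (auto simp: l_def p_def)
    ultimately show ?thesis by simp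
  qed
  have "(\<epsilon> - 2 * \<theta>) * L \<le> (\<Sum>v\<in>V. \<Sum>a\<in>A. p v a * B.avg (\<lambda>v. p v a) v)"
    unfolding L_def sum_distrib_left by (intro sum_mono light)
  \<comment> \<open>Parallel edges share their label, so after the swap each label \<open>a\<close>
    contributes the form of the second graph at one small set.\<close>
  also have "\<dots> = (\<Sum>a\<in>A. \<Sum>v\<in>V. p v a * B.avg (\<lambda>v. p v a) v)" by (rule sum.swap)
  also have "\<dots> \<le> (\<Sum>a\<in>A. (\<xi> + lam) * (\<Sum>v\<in>V. p v a))"
  proof (intro sum_mono)
    fix a assume a: "a \<in> A"
    define X where "X = {v \<in> V. P v a}"
    have "(\<Sum>v\<in>V. of_bool (v \<in> X) * B.avg (\<lambda>v. of_bool (v \<in> X)) v) \<le> (\<xi> + lam) * real (card X)"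
      using small[OF a] by (intro B.small_set_avg) (auto simp: X_def)
    moreover have "(\<Sum>v\<in>V. p v a * B.avg (\<lambda>v. p v a) v)
        = (\<Sum>v\<in>V. of_bool (v \<in> X) * B.avg (\<lambda>v. of_bool (v \<in> X)) v)"
      unfolding B.avg_def by (intro sum.cong arg_cong2[where f="(*)"] arg_cong2[where f="(/)"])
        (auto simp: p_def X_def B.s_closed)
    moreover have "(\<Sum>v\<in>V. p v a) = real (card X)"
      by (simp add: p_def X_def B.fin_V Int_def)
    ultimately show "(\<Sum>v\<in>V. p v a * B.avg (\<lambda>v. p v a) v) \<le> (\<xi> + lam) * (\<Sum>v\<in>V. p v a)"
      by simp
  qed
  also have "\<dots> = (\<xi> + lam) * N"
    unfolding N_def by (subst sum.swap) (simp add: sum_distrib_left)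
  also have "\<dots> \<le> (\<epsilon> - 2 * \<theta>) / 100 * N"
    using \<xi> by (intro mult_right_mono) (auto simp: N_def p_def intro!: sum_nonneg)
  finally have "(\<epsilon> - 2 * \<theta>) * (100 * L) \<le> (\<epsilon> - 2 * \<theta>) * N" by simp
  hence L_le: "100 * L \<le> N" using \<theta> by (simp only: mult_le_cancel_left_pos diff_gt_0_iff_gt)
  \<comment> \<open>A bad edge that is not light has a heavy end. A heavy far end becomes the near
    end of the reversed edge, whence the factor 2 in the conclusion.\<close>
  have "p v a \<le> l v a + (of_bool (\<theta> \<le> w v) * p v a + of_bool (\<theta> \<le> w (s a v)) * p (s a v) (i a))"
    if "v \<in> V" "a \<in> A" for v a using sym[OF that] by (auto simp: p_def l_def)
  hence "N \<le> (\<Sum>v\<in>V. \<Sum>a\<in>A. l v a + (of_bool (\<theta> \<le> w v) * p v a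
      + of_bool (\<theta> \<le> w (s a v)) * p (s a v) (i a)))"
    unfolding N_def by (intro sum_mono)
  also have "\<dots> = L + (H + (\<Sum>v\<in>V. \<Sum>a\<in>A. of_bool (\<theta> \<le> w (s a v)) * p (s a v) (i a)))"
    by (simp only: sum.distrib L_def H_def)
  also have "(\<Sum>v\<in>V. \<Sum>a\<in>A. of_bool (\<theta> \<le> w (s a v)) * p (s a v) (i a)) = H"
    unfolding H_def by (rule A.sum_reverse_edges[symmetric])
  finally have "0.99 * N \<le> 2 * H" using L_le by simp
  hence "0.99 * (N / real (card A)) \<le> 2 * (H / real (card A))"
    using divide_right_mono[of "0.99 * N" "2 * H" "real (card A)"] by simp
  moreover have "(\<Sum>v\<in>V. edge_fraction A P v) = N / real (card A)"
    by (simp add: edge_fraction_altdef A.fin_A N_def p_def sum_divide_distrib del: sum_of_bool_eq)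
  moreover have "(\<Sum>v\<in>V. of_bool (\<theta> \<le> w v) * edge_fraction A P v) = H / real (card A)"
    by (simp add: edge_fraction_altdef A.fin_A H_def p_def sum_divide_distrib sum_distrib_left
        del: sum_of_bool_eq sum_of_bool_mult_eq sum_mult_of_bool_eq)
  ultimately show ?thesis by simp
qed

text \<open>Sum \<open>local_min\<close> over the heavy vertices, that is, against their indicator
  \<open>h\<close>. By expansion the right sides add up to at most
  \<open>\<epsilon> * \<rho> / 10\<close>. The heavy vertices carry at least 0.495 of the total load
  \<open>\<rho>\<close>, so the left sides add up to at least 0.198
  \<open>\<epsilon> * \<rho>\<close>. Hence \<open>\<rho> = 0\<close>.\<close>

lemma load_eq_zeroI:
  fixes s :: "'a \<Rightarrow> 'v \<Rightarrow> 'v" and t :: "'b \<Rightarrow> 'v \<Rightarrow> 'v" and \<alpha> \<beta> :: "'v \<Rightarrow> real"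
  assumes "expanding_graph V A s i lam" and "expanding_graph V B t j lam"
    and \<alpha>: "\<And>v. v \<in> V \<Longrightarrow> 0 \<le> \<alpha> v \<and> \<alpha> v \<le> 1" and \<beta>: "\<And>v. v \<in> V \<Longrightarrow> 0 \<le> \<beta> v \<and> \<beta> v \<le> 1"
    and \<epsilon>: "0 < \<epsilon>" "\<epsilon> \<le> 1" and lam: "lam \<le> \<epsilon>\<^sup>2 / 2500"
    and local_min: "\<And>v. v \<in> V \<Longrightarrow> \<epsilon> / 2 * (\<alpha> v + \<beta> v - \<epsilon> / 100)
      \<le> labelled_graph.avg A s \<beta> v + labelled_graph.avg B t \<alpha> v"
    and heavy_\<alpha>: "0.99 * (\<Sum>v\<in>V. \<alpha> v) \<le> 2 * (\<Sum>v\<in>V. of_bool (\<epsilon> / 20 \<le> \<alpha> v + \<beta> v) * \<alpha> v)"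
    and heavy_\<beta>: "0.99 * (\<Sum>v\<in>V. \<beta> v) \<le> 2 * (\<Sum>v\<in>V. of_bool (\<epsilon> / 20 \<le> \<alpha> v + \<beta> v) * \<beta> v)"
    and small: "(\<Sum>v\<in>V. \<alpha> v + \<beta> v) \<le> \<epsilon> ^ 3 / 31250 * real (card V)"
  shows "(\<Sum>v\<in>V. \<alpha> v + \<beta> v) = 0"
proof -
  interpret A: expanding_graph V A s i lam by fact
  interpret B: expanding_graph V B t j lam by fact
  define \<rho> where "\<rho> = (\<Sum>v\<in>V. \<alpha> v + \<beta> v)"
  define h :: "'v \<Rightarrow> real" where "h v = of_bool (\<epsilon> / 20 \<le> \<alpha> v + \<beta> v)" for v
  define n where "n = real (card V)"
  have n: "n > 0" using A.card_V_pos by (simp add: n_def)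
  have \<rho>0: "\<rho> \<ge> 0" unfolding \<rho>_def using \<alpha> \<beta> by (intro sum_nonneg) force
  have h01: "0 \<le> h v" "h v \<le> 1" for v by (auto simp: h_def)
  \<comment> \<open>Markov's inequality for the threshold \<open>\<epsilon> / 20\<close>.\<close>
  have "h v \<le> 20 / \<epsilon> * (\<alpha> v + \<beta> v)" if "v \<in> V" for v
    using \<alpha>[OF that] \<beta>[OF that] \<epsilon> by (auto simp: h_def field_simps)
  hence "(\<Sum>v\<in>V. h v) \<le> (\<Sum>v\<in>V. 20 / \<epsilon> * (\<alpha> v + \<beta> v))" by (intro sum_mono)
  hence h_le: "(\<Sum>v\<in>V. h v) \<le> 20 / \<epsilon> * \<rho>" by (simp add: sum_distrib_left \<rho>_def)
  have "\<rho> / \<epsilon> \<ge> \<rho>" using \<epsilon> \<rho>0 by (simp add: le_divide_eq mult_left_le)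
  have sq: "(\<Sum>v\<in>V. (h v + \<gamma> v)\<^sup>2) \<le> 2 * (\<Sum>v\<in>V. h v + \<gamma> v)"
    if \<gamma>: "\<And>v. v \<in> V \<Longrightarrow> 0 \<le> \<gamma> v \<and> \<gamma> v \<le> 1" for \<gamma>
    unfolding sum_distrib_left
  proof (intro sum_mono)
    fix v assume "v \<in> V"
    hence "0 \<le> h v + \<gamma> v" "h v + \<gamma> v \<le> 2" using \<gamma>[of v] h01[of v] by auto
    thus "(h v + \<gamma> v)\<^sup>2 \<le> 2 * (h v + \<gamma> v)"
      using mult_right_mono[of "h v + \<gamma> v" 2 "h v + \<gamma> v"] by (simp add: power2_eq_square)
  qed
  \<comment> \<open>\<open>S\<close> and \<open>T\<close> stand for the sum and the sum of squares
    of \<open>h + \<gamma>\<close>. The number 21 is 20 from Markov plus 1 from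
    \<open>\<gamma>\<close>, and 42 doubles it because \<open>h + \<gamma>\<close> is at most 2. The
    cubic bound on the load absorbs \<open>1 / \<epsilon>\<^sup>2\<close>, and the bound on
    \<open>lam\<close> absorbs \<open>1 / \<epsilon>\<close>.\<close>
  have bound: "(S::real)\<^sup>2 / n + lam * T \<le> \<epsilon> * \<rho> / 20"
    if "0 \<le> S" "S \<le> 21 * \<rho> / \<epsilon>" "T \<le> 42 * \<rho> / \<epsilon>" for S T
  proof -
    have "S\<^sup>2 \<le> (21 * \<rho> / \<epsilon>)\<^sup>2" using that by (intro power_mono) auto
    also have "\<dots> = 441 * \<rho> / \<epsilon>\<^sup>2 * \<rho>" by (simp add: power2_eq_square)
    also have "\<dots> \<le> 441 * \<rho> / \<epsilon>\<^sup>2 * (\<epsilon> ^ 3 / 31250 * n)"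
      using small \<rho>0 by (intro mult_left_mono) (auto simp: \<rho>_def n_def)
    also have "\<dots> = 441 / 31250 * \<epsilon> * \<rho> * n" using \<epsilon> by (simp add: power2_eq_square power3_eq_cube)
    finally have 1: "S\<^sup>2 / n \<le> 441 / 31250 * (\<epsilon> * \<rho>)" using n by (simp add: divide_le_eq)
    have "lam * T \<le> lam * (42 * \<rho> / \<epsilon>)" using that A.lam_nonneg by (intro mult_left_mono)
    also have "\<dots> \<le> \<epsilon>\<^sup>2 / 2500 * (42 * \<rho> / \<epsilon>)" using lam \<rho>0 \<epsilon> by (intro mult_right_mono) auto
    also have "\<dots> = 42 / 2500 * (\<epsilon> * \<rho>)" using \<epsilon> by (simp add: power2_eq_square)
    finally have "S\<^sup>2 / n + lam * T \<le> (441 / 31250 + 42 / 2500) * (\<epsilon> * \<rho>)" unfolding distrib_right using 1 by linarith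
    also have "\<dots> \<le> 1 / 20 * (\<epsilon> * \<rho>)" using \<epsilon> \<rho>0 by (intro mult_right_mono) auto
    finally show ?thesis by simp
  qed
  have mix: "2 * (X::real) \<le> \<epsilon> * \<rho> / 10"
    if le: "2 * X \<le> (\<Sum>v\<in>V. h v + \<gamma> v)\<^sup>2 / n + lam * (\<Sum>v\<in>V. (h v + \<gamma> v)\<^sup>2)"
      and \<gamma>: "\<And>v. v \<in> V \<Longrightarrow> 0 \<le> \<gamma> v \<and> \<gamma> v \<le> 1" "(\<Sum>v\<in>V. \<gamma> v) \<le> \<rho>" for X \<gamma>
  proof -
    have nn: "0 \<le> (\<Sum>v\<in>V. h v + \<gamma> v)" using h01 \<gamma>(1) by (intro sum_nonneg) (simp add: add_nonneg_nonneg)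
    have s: "(\<Sum>v\<in>V. h v + \<gamma> v) \<le> 21 * \<rho> / \<epsilon>"
      using h_le \<gamma>(2) \<open>\<rho> / \<epsilon> \<ge> \<rho>\<close> by (simp add: sum.distrib)
    have "(\<Sum>v\<in>V. (h v + \<gamma> v)\<^sup>2) \<le> 42 * \<rho> / \<epsilon>" using sq[of \<gamma>, OF \<gamma>(1)] s by simp
    hence "2 * X \<le> \<epsilon> * \<rho> / 20" by (rule order_trans[OF le bound[OF nn s]])
    moreover have "\<epsilon> * \<rho> \<ge> 0" using \<rho>0 \<epsilon> by simp
    ultimately show ?thesis by linarith
  qed
  have "2 * (\<Sum>v\<in>V. h v * A.avg \<beta> v) \<le> \<epsilon> * \<rho> / 10"
  proof (rule mix)
    show "(\<Sum>v\<in>V. \<beta> v) \<le> \<rho>" unfolding \<rho>_def using \<alpha> by (intro sum_mono) auto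
    show "2 * (\<Sum>v\<in>V. h v * A.avg \<beta> v) \<le> (\<Sum>v\<in>V. h v + \<beta> v)\<^sup>2 / n + lam * (\<Sum>v\<in>V. (h v + \<beta> v)\<^sup>2)"
      unfolding n_def by (intro A.bilinear_mixing) (use h01 \<beta> in auto)
  qed (use \<beta> in auto)
  moreover have "2 * (\<Sum>v\<in>V. h v * B.avg \<alpha> v) \<le> \<epsilon> * \<rho> / 10"
  proof (rule mix)
    show "(\<Sum>v\<in>V. \<alpha> v) \<le> \<rho>" unfolding \<rho>_def using \<beta> by (intro sum_mono) auto
    show "2 * (\<Sum>v\<in>V. h v * B.avg \<alpha> v) \<le> (\<Sum>v\<in>V. h v + \<alpha> v)\<^sup>2 / n + lam * (\<Sum>v\<in>V. (h v + \<alpha> v)\<^sup>2)"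
      unfolding n_def by (intro B.bilinear_mixing) (use h01 \<alpha> in auto)
  qed (use \<alpha> in auto)
  moreover have "0.4 * \<epsilon> * (\<Sum>v\<in>V. h v * (\<alpha> v + \<beta> v))
      \<le> (\<Sum>v\<in>V. h v * A.avg \<beta> v) + (\<Sum>v\<in>V. h v * B.avg \<alpha> v)"
    unfolding sum_distrib_left sum.distrib[symmetric]
  proof (intro sum_mono)
    fix v assume v: "v \<in> V"
    show "0.4 * \<epsilon> * (h v * (\<alpha> v + \<beta> v)) \<le> h v * A.avg \<beta> v + h v * B.avg \<alpha> v"
    proof (cases "\<epsilon> / 20 \<le> \<alpha> v + \<beta> v")
      case True
      \<comment> \<open>The threshold is five times the slack \<open>\<epsilon> / 100\<close>, so
        the slack costs at most a fifth of a heavy load.\<close>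
      hence "0.8 * (\<alpha> v + \<beta> v) \<le> \<alpha> v + \<beta> v - \<epsilon> / 100" by simp
      hence "\<epsilon> / 2 * (0.8 * (\<alpha> v + \<beta> v)) \<le> \<epsilon> / 2 * (\<alpha> v + \<beta> v - \<epsilon> / 100)"
        using \<epsilon> by (intro mult_left_mono) auto
      also note local_min[OF v]
      finally have "0.4 * \<epsilon> * (\<alpha> v + \<beta> v) \<le> A.avg \<beta> v + B.avg \<alpha> v" by (simp add: algebra_simps)
      thus ?thesis using True by (simp add: h_def)
    qed (simp add: h_def)
  qed
  moreover have "0.99 * \<rho> \<le> 2 * (\<Sum>v\<in>V. h v * (\<alpha> v + \<beta> v))"
    using heavy_\<alpha> heavy_\<beta> by (simp add: \<rho>_def h_def sum.distrib distrib_left)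
  hence "0.2 * \<epsilon> * (0.99 * \<rho>) \<le> 0.2 * \<epsilon> * (2 * (\<Sum>v\<in>V. h v * (\<alpha> v + \<beta> v)))"
    using \<epsilon> by (intro mult_left_mono) auto
  ultimately have "\<epsilon> * \<rho> \<le> 0" by (simp add: algebra_simps)
  with \<epsilon> \<rho>0 show ?thesis unfolding \<rho>_def[symmetric] by (simp add: mult_le_0_iff)
qed

section \<open>The square complex\<close>

text \<open>Without loops and repeated labels an undirected edge comes from exactly two pairs
  \<open>(v, a)\<close>, so sets of edges can be counted through pairs.\<close>

locale simple_labelled_graph = labelled_graph V A s i
  for V :: "'v set" and A :: "'a set" and s :: "'a \<Rightarrow> 'v \<Rightarrow> 'v" and i :: "'a \<Rightarrow> 'a" +
  assumes no_loops: "a \<in> A \<Longrightarrow> v \<in> V \<Longrightarrow> s a v \<noteq> v"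
    and s_inj: "a \<in> A \<Longrightarrow> a' \<in> A \<Longrightarrow> v \<in> V \<Longrightarrow> s a v = s a' v \<Longrightarrow> a = a'"
begin

definition edges :: "'v set set" where
  "edges = {{v, s a v} | v a. v \<in> V \<and> a \<in> A}"

lemma edge_eq_iff:
  assumes "v \<in> V" "a \<in> A" "v' \<in> V" "a' \<in> A"
  shows "{v, s a v} = {v', s a' v'} \<longleftrightarrow> v' = v \<and> a' = a \<or> v' = s a v \<and> a' = i a"
proof
  assume eq: "{v, s a v} = {v', s a' v'}"
  show "v' = v \<and> a' = a \<or> v' = s a v \<and> a' = i a"
  proof (cases "v' = v")
    case True
    thus ?thesis using eq assms s_inj by (metis doubleton_eq_iff)
  next
    case False
    hence "v' = s a v" "s a' v' = v" using eq by (auto simp: doubleton_eq_iff)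
    thus ?thesis using assms s_inj s_i i_closed by metis
  qed
qed (use assms s_i in auto)

lemma finite_edges: "finite edges"
proof -
  have "edges = (\<lambda>(v, a). {v, s a v}) ` (V \<times> A)" by (auto simp: edges_def)
  thus ?thesis using fin_V fin_A by simp
qed

lemma neighbours_edges:
  assumes "v \<in> V"
  shows "neighbours V edges v = (\<lambda>a. s a v) ` A"
proof
  show "neighbours V edges v \<subseteq> (\<lambda>a. s a v) ` A"
  proof
    fix u assume "u \<in> neighbours V edges v"
    then obtain v' a where *: "v' \<in> V" "a \<in> A" "{v, u} = {v', s a v'}"
      by (auto simp: neighbours_def edges_def)
    show "u \<in> (\<lambda>a. s a v) ` A"
    proof (cases "v' = v")
      case True
      with * show ?thesis by (metis doubleton_eq_iff imageI)
    next
      case False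
      hence "v = s a v'" "u = v'" using * by (auto simp: doubleton_eq_iff)
      thus ?thesis using * s_i i_closed by (metis imageI)
    qed
  qed
qed (use assms s_closed in \<open>auto simp: neighbours_def edges_def\<close>)

lemma sum_neighbours:
  assumes "v \<in> V"
  shows "(\<Sum>u\<in>neighbours V edges v. f u) = (\<Sum>a\<in>A. f (s a v))"
  unfolding neighbours_edges[OF assms]
  using s_inj[OF _ _ assms] by (subst sum.reindex) (auto intro: inj_onI)

text \<open>The degree is existentially quantified in \<open>expander\<close>; distinct labels lead
  to distinct neighbours, which forces it to be \<open>card A\<close>.\<close>

lemma expanding_graphI:
  assumes "expander V edges lam" and "lam \<ge> 0"
  shows "expanding_graph V A s i lam"
proof
  obtain k where k: "k > 0" "regular_graph V edges k"
    "\<And>\<mu>. sum_zero_eigenvalue V edges k \<mu> \<Longrightarrow> \<mu> \<le> lam"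
    using assms(1) by (auto simp: expander_def)
  obtain v where v: "v \<in> V" using V_ne by blast
  have "card (neighbours V edges v) = card A"
    using sum_neighbours[OF v, of "\<lambda>_. 1::nat"] by simp
  with k v have kA: "k = card A" by (simp add: regular_graph_def)
  fix f :: "_ \<Rightarrow> real"
  have "(\<Sum>v\<in>V. f v * avg f v) = (\<Sum>v\<in>V. f v * (1 / real k * (\<Sum>u\<in>neighbours V edges v. f u)))"
    by (intro sum.cong refl) (simp add: avg_def kA sum_neighbours)
  also have "\<dots> \<le> (\<Sum>v\<in>V. f v)\<^sup>2 / real (card V) + lam * (\<Sum>v\<in>V. (f v)\<^sup>2)"
    by (intro expander_quadratic_form fin_V k assms(2))
  finally show "(\<Sum>v\<in>V. f v * avg f v) \<le> (\<Sum>v\<in>V. f v)\<^sup>2 / real (card V) + lam * (\<Sum>v\<in>V. (f v)\<^sup>2)" .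
qed (fact assms(2))

text \<open>Double counting: \<open>\<phi>\<close> is two-to-one from the pairs in \<open>P\<close>
  onto the edges in \<open>Q\<close>. That \<open>P\<close> is symmetric under reversal is implied
  by its being read off from the edge.\<close>

lemma sum_edge_fraction:
  assumes Q: "\<And>v a. v \<in> V \<Longrightarrow> a \<in> A \<Longrightarrow> Q {v, s a v} = P v a"
  shows "(\<Sum>v\<in>V. edge_fraction A P v) = 2 * real (card {e \<in> edges. Q e}) / real (card A)"
proof -
  define X where "X = {(v, a). v \<in> V \<and> a \<in> A \<and> P v a}"
  define \<phi> where "\<phi> = (\<lambda>(v, a). {v, s a v})"
  have fin: "finite X" by (rule finite_subset[of _ "V \<times> A"]) (auto simp: X_def fin_V fin_A)
  have img: "\<phi> ` X = {e \<in> edges. Q e}" using Q by (auto simp: X_def \<phi>_def edges_def image_iff)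
  have "card {x \<in> X. \<phi> x = e} = 2" if "e \<in> \<phi> ` X" for e
  proof -
    from that obtain v a where va: "v \<in> V" "a \<in> A" "P v a" "e = {v, s a v}"
      by (auto simp: X_def \<phi>_def)
    have "P (s a v) (i a)"
      using Q[of "s a v" "i a"] Q[of v a] va s_closed i_closed s_i by (simp add: insert_commute)
    hence "(v, a) \<in> X" "(s a v, i a) \<in> X" using va s_closed i_closed by (auto simp: X_def)
    moreover have "\<phi> (v', a') = e \<longleftrightarrow> (v', a') = (v, a) \<or> (v', a') = (s a v, i a)"
      if "(v', a') \<in> X" for v' a'
      using edge_eq_iff[OF va(1,2), of v' a'] that va(4) by (auto simp: X_def \<phi>_def)
    ultimately have "{x \<in> X. \<phi> x = e} = {(v, a), (s a v, i a)}" by (auto; metis)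
    thus ?thesis using no_loops[OF va(2,1)] by simp
  qed
  hence "card X = 2 * card {e \<in> edges. Q e}"
    using sum.image_gen[OF fin, of "\<lambda>_. 1::nat" \<phi>] by (simp add: img)
  moreover have "X = Sigma V (\<lambda>v. {a \<in> A. P v a})" by (auto simp: X_def)
  hence "card X = (\<Sum>v\<in>V. card {a \<in> A. P v a})" using fin_V fin_A by simp
  ultimately show ?thesis
    by (simp add: edge_fraction_def sum_divide_distrib[symmetric] flip: of_nat_sum)
qed

lemma card_edges: "2 * card edges = card V * card A"
proof -
  have "edge_fraction A (\<lambda>_ _. True) v = 1" for v
    using card_A_pos by (simp add: edge_fraction_def)
  hence "(\<Sum>v\<in>V. edge_fraction A (\<lambda>_ _. True) v) = (\<Sum>v\<in>V. 1)" by (intro sum.cong refl)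
  hence "real (card V) = 2 * real (card edges) / real (card A)"
    using sum_edge_fraction[of "\<lambda>_. True" "\<lambda>_ _. True"] by simp
  hence "real (2 * card edges) = real (card V * card A)"
    using card_A_pos by (simp add: field_simps)
  thus ?thesis by (simp only: of_nat_eq_iff)
qed

text \<open>Every edge at \<open>g\<close> is counted once at \<open>g\<close> and once at its other
  end, which differs from \<open>g\<close>; all remaining edges cancel.\<close>

lemma sum_edge_fraction_change:
  assumes sym: "\<And>v a. v \<in> V \<Longrightarrow> a \<in> A \<Longrightarrow> P (s a v) (i a) = P v a"
    and sym': "\<And>v a. v \<in> V \<Longrightarrow> a \<in> A \<Longrightarrow> P' (s a v) (i a) = P' v a"
    and eq: "\<And>v a. v \<in> V \<Longrightarrow> a \<in> A \<Longrightarrow> v \<noteq> g \<Longrightarrow> s a v \<noteq> g \<Longrightarrow> P v a = P' v a"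
    and g: "g \<in> V"
  shows "(\<Sum>v\<in>V. edge_fraction A P v) - (\<Sum>v\<in>V. edge_fraction A P' v)
    = 2 * (edge_fraction A P g - edge_fraction A P' g)"
proof -
  define rest where "rest P = (\<Sum>v\<in>V. \<Sum>a\<in>A. of_bool (v \<noteq> g \<and> s a v \<noteq> g \<and> P v a) :: real)"
    for P :: "_ \<Rightarrow> _ \<Rightarrow> bool"
  have *: "(\<Sum>v\<in>V. edge_fraction A P v) = rest P / real (card A) + 2 * edge_fraction A P g"
    if sym: "\<And>v a. v \<in> V \<Longrightarrow> a \<in> A \<Longrightarrow> P (s a v) (i a) = P v a" for P
  proof -
    have "(\<Sum>v\<in>V. \<Sum>a\<in>A. of_bool (P v a)) = (\<Sum>v\<in>V. \<Sum>a\<in>A.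
        of_bool (v \<noteq> g \<and> s a v \<noteq> g \<and> P v a) + of_bool (v = g \<and> P v a)
        + (of_bool (s a v = g \<and> P (s a v) (i a)) :: real))"
      using sym no_loops by (intro sum.cong refl) auto
    also have "\<dots> = rest P + (\<Sum>v\<in>V. \<Sum>a\<in>A. of_bool (v = g \<and> P v a))
        + (\<Sum>v\<in>V. \<Sum>a\<in>A. of_bool (s a v = g \<and> P (s a v) (i a)))"
      by (simp only: sum.distrib rest_def)
    also have "(\<Sum>v\<in>V. \<Sum>a\<in>A. of_bool (s a v = g \<and> P (s a v) (i a)))
        = (\<Sum>v\<in>V. \<Sum>a\<in>A. of_bool (v = g \<and> P v a))" by (rule sum_reverse_edges[symmetric])
    also have "(\<Sum>v\<in>V. \<Sum>a\<in>A. of_bool (v = g \<and> P v a))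
        = (\<Sum>v\<in>V. if v = g then (\<Sum>a\<in>A. of_bool (P v a)) else 0)"
      by (intro sum.cong refl) simp
    also have "\<dots> = (\<Sum>a\<in>A. of_bool (P g a))" using g fin_V by simp
    finally show ?thesis
      by (simp add: edge_fraction_altdef fin_A sum_divide_distrib[symmetric] add_divide_distrib
          del: sum_of_bool_eq)
  qed
  have "rest P = rest P'" unfolding rest_def using eq by (intro sum.cong refl) auto
  thus ?thesis by (simp add: *[of P, OF sym] *[of P', OF sym'])
qed

end

locale square_complex = group G for G (structure) +
  fixes A B :: "'a set"
  assumes fin_G: "finite (carrier G)"
    and A_sub: "A \<subseteq> carrier G - {\<one>}" and B_sub: "B \<subseteq> carrier G - {\<one>}"
    and A_inv: "(\<lambda>a. inv a) ` A = A" and B_inv: "(\<lambda>b. inv b) ` B = B"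
    and not_conj: "\<forall>a\<in>A. \<forall>b\<in>B. \<forall>g\<in>carrier G. g \<otimes> a \<otimes> inv g \<noteq> b"
    and A_nonempty: "A \<noteq> {}" and B_nonempty: "B \<noteq> {}"
begin

lemma A_closed [simp]: "a \<in> A \<Longrightarrow> a \<in> carrier G" using A_sub by auto
lemma B_closed [simp]: "b \<in> B \<Longrightarrow> b \<in> carrier G" using B_sub by auto
lemma inv_A [simp]: "a \<in> A \<Longrightarrow> inv a \<in> A" using A_inv by auto
lemma inv_B [simp]: "b \<in> B \<Longrightarrow> inv b \<in> B" using B_inv by auto
lemma inv_A_cancel [simp]: "a \<in> A \<Longrightarrow> g \<in> carrier G \<Longrightarrow> inv a \<otimes> (a \<otimes> g) = g"
  by (simp add: m_assoc[symmetric])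
lemma inv_B_cancel [simp]: "b \<in> B \<Longrightarrow> g \<in> carrier G \<Longrightarrow> g \<otimes> b \<otimes> inv b = g"
  by (simp add: m_assoc)

sublocale L: simple_labelled_graph "carrier G" A "\<lambda>a g. a \<otimes> g" "\<lambda>a. inv a"
proof
  show "finite A" using A_sub fin_G finite_subset by blast
  show "a \<otimes> v \<noteq> v" if "a \<in> A" "v \<in> carrier G" for a v
    using that A_sub by auto
qed (use fin_G A_nonempty in auto)

sublocale R: simple_labelled_graph "carrier G" B "\<lambda>b g. g \<otimes> b" "\<lambda>b. inv b"
proof
  show "finite B" using B_sub fin_G finite_subset by blast
  show "v \<otimes> b \<noteq> v" if "b \<in> B" "v \<in> carrier G" for b v
    using that B_sub by auto
qed (use fin_G B_nonempty in auto)

lemma left_edges: "cay_left_edges G A = L.edges"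
  by (simp add: cay_left_edges_def L.edges_def)

lemma right_edges: "cay_right_edges G B = R.edges"
  by (simp add: cay_right_edges_def R.edges_def)

text \<open>A common edge would give kb' = ak for some k, b', and thus make a and b' conjugate,
  against \<open>not_conj\<close>.\<close>

lemma edges_differ:
  assumes "g \<in> carrier G" "h \<in> carrier G" "a \<in> A" "b \<in> B"
  shows "{g, a \<otimes> g} \<noteq> {h, h \<otimes> b}"
proof
  have ne: "k \<otimes> b' \<noteq> a \<otimes> k" if "k \<in> carrier G" "b' \<in> B" for k b'
  proof
    assume "k \<otimes> b' = a \<otimes> k"
    hence "inv k \<otimes> a \<otimes> inv (inv k) = b'"
      using that assms by (simp add: m_assoc) (metis B_closed inv_closed l_inv l_one m_assoc)
    thus False using not_conj that assms by (metis inv_closed)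
  qed
  assume "{g, a \<otimes> g} = {h, h \<otimes> b}"
  hence "g = h \<and> a \<otimes> g = h \<otimes> b \<or> g = h \<otimes> b \<and> a \<otimes> g = h" by (auto simp: doubleton_eq_iff)
  thus False
  proof
    assume "g = h \<otimes> b \<and> a \<otimes> g = h"
    hence "g \<otimes> inv b = a \<otimes> g" using assms by (metis inv_B_cancel)
    thus False using ne[of g "inv b"] assms by simp
  qed (use ne[of g b] assms in auto)
qed

lemma edges_disjoint: "L.edges \<inter> R.edges = {}"
  using edges_differ by (fastforce simp: L.edges_def R.edges_def)

section \<open>Violated edges, loads and the violation weight\<close>

definition viol_left :: "('a \<Rightarrow> 'a \<times> 'a \<Rightarrow> 'f) \<Rightarrow> 'a \<Rightarrow> 'a \<Rightarrow> bool" where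
  "viol_left f g a \<longleftrightarrow> row B a (f g) \<noteq> row B (inv a) (f (a \<otimes> g))"

definition viol_right :: "('a \<Rightarrow> 'a \<times> 'a \<Rightarrow> 'f) \<Rightarrow> 'a \<Rightarrow> 'a \<Rightarrow> bool" where
  "viol_right f g b \<longleftrightarrow> col A b (f g) \<noteq> col A (inv b) (f (g \<otimes> b))"

lemma viol_left_sym:
  "g \<in> carrier G \<Longrightarrow> a \<in> A \<Longrightarrow> viol_left f (a \<otimes> g) (inv a) = viol_left f g a"
  by (auto simp: viol_left_def)

lemma viol_right_sym:
  "g \<in> carrier G \<Longrightarrow> b \<in> B \<Longrightarrow> viol_right f (g \<otimes> b) (inv b) = viol_right f g b"
  by (auto simp: viol_right_def)

text \<open>\<open>violated\<close> ranges over all ways to write the edge. Those as a right edge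
  are impossible, and the only two as a left edge are mutual reversals, on which
  \<open>viol_left\<close> agrees.\<close>

lemma violated_left:
  assumes "g \<in> carrier G" "a \<in> A"
  shows "violated G A B f {g, a \<otimes> g} = viol_left f g a"
proof -
  have "violated G A B f {g, a \<otimes> g} \<longleftrightarrow>
      (\<exists>h\<in>carrier G. \<exists>c\<in>A. {g, a \<otimes> g} = {h, c \<otimes> h} \<and> viol_left f h c)"
    unfolding violated_def viol_left_def using edges_differ assms by blast
  also have "\<dots> \<longleftrightarrow> viol_left f g a"
    using assms viol_left_sym[OF assms, of f] by (auto simp: L.edge_eq_iff[OF assms])
  finally show ?thesis .
qed

lemma violated_right:
  assumes "g \<in> carrier G" "b \<in> B"
  shows "violated G A B f {g, g \<otimes> b} = viol_right f g b"
proof -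
  have "violated G A B f {g, g \<otimes> b} \<longleftrightarrow>
      (\<exists>h\<in>carrier G. \<exists>c\<in>B. {g, g \<otimes> b} = {h, h \<otimes> c} \<and> viol_right f h c)"
    unfolding violated_def viol_right_def using edges_differ assms by blast
  also have "\<dots> \<longleftrightarrow> viol_right f g b"
    using assms viol_right_sym[OF assms, of f] by (auto simp: R.edge_eq_iff[OF assms])
  finally show ?thesis .
qed

abbreviation "n \<equiv> real (card (carrier G))"

definition load :: "('a \<Rightarrow> 'a \<times> 'a \<Rightarrow> 'f) \<Rightarrow> 'a \<Rightarrow> real" where
  "load f g = edge_fraction A (viol_left f) g + edge_fraction B (viol_right f) g"

lemma violation_weight_card:
  "violation_weight G A B f =
    real (card {e \<in> L.edges. violated G A B f e}) / (real (card A) * n)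
    + real (card {e \<in> R.edges. violated G A B f e}) / (real (card B) * n)"
proof -
  have split: "{e \<in> square_edges G A B. violated G A B f e}
      = {e \<in> L.edges. violated G A B f e} \<union> {e \<in> R.edges. violated G A B f e}"
    by (auto simp: square_edges_def left_edges right_edges)
  have "violation_weight G A B f
      = (\<Sum>e\<in>{e \<in> L.edges. violated G A B f e}. edge_weight G A B e)
        + (\<Sum>e\<in>{e \<in> R.edges. violated G A B f e}. edge_weight G A B e)"
    unfolding violation_weight_def split
    using edges_disjoint L.finite_edges R.finite_edges by (intro sum.union_disjoint) auto
  also have "(\<Sum>e\<in>{e \<in> L.edges. violated G A B f e}. edge_weight G A B e)
      = (\<Sum>e\<in>{e \<in> L.edges. violated G A B f e}. 1 / (real (card A) * n))"
    by (intro sum.cong refl) (simp add: edge_weight_def left_edges)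
  also have "(\<Sum>e\<in>{e \<in> R.edges. violated G A B f e}. edge_weight G A B e)
      = (\<Sum>e\<in>{e \<in> R.edges. violated G A B f e}. 1 / (real (card B) * n))"
    using edges_disjoint by (intro sum.cong refl) (auto simp: edge_weight_def left_edges)
  finally show ?thesis by simp
qed

text \<open>A violated left edge adds 1/|A| to the load of both its ends and has weight 1/(|A||G|);
  likewise on the right.\<close>

lemma sum_load: "(\<Sum>g\<in>carrier G. load f g) = 2 * n * violation_weight G A B f"
  using L.card_V_pos
  by (simp add: load_def sum.distrib violation_weight_card distrib_left
      L.sum_edge_fraction[of "violated G A B f" "viol_left f"] violated_left
      R.sum_edge_fraction[of "violated G A B f" "viol_right f"] violated_right)

lemma load_nonneg: "load f g \<ge> 0"
  by (simp add: load_def edge_fraction_bounds)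

lemma violation_weight_nonneg: "violation_weight G A B f \<ge> 0"
  by (simp add: violation_weight_card)

text \<open>Only edges at \<open>g\<close> change their status. This identity turns the threshold
  q/|G| of the Correction Algorithm into a load difference \<open>q\<close> at one vertex.\<close>

lemma violation_weight_change:
  assumes g: "g \<in> carrier G"
  shows "violation_weight G A B f - violation_weight G A B (f(g := m))
    = (load f g - load (f(g := m)) g) / n"
proof -
  let ?f' = "f(g := m)"
  have "(\<Sum>v\<in>carrier G. edge_fraction A (viol_left f) v)
      - (\<Sum>v\<in>carrier G. edge_fraction A (viol_left ?f') v)
      = 2 * (edge_fraction A (viol_left f) g - edge_fraction A (viol_left ?f') g)"
    by (intro L.sum_edge_fraction_change g viol_left_sym) (auto simp: viol_left_def)
  moreover have "(\<Sum>v\<in>carrier G. edge_fraction B (viol_right f) v)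
      - (\<Sum>v\<in>carrier G. edge_fraction B (viol_right ?f') v)
      = 2 * (edge_fraction B (viol_right f) g - edge_fraction B (viol_right ?f') g)"
    by (intro R.sum_edge_fraction_change g viol_right_sym) (auto simp: viol_right_def)
  ultimately have "2 * n * violation_weight G A B f - 2 * n * violation_weight G A B ?f'
      = 2 * (load f g - load ?f' g)"
    unfolding sum_load[symmetric] by (simp add: load_def sum.distrib algebra_simps)
  thus ?thesis using L.card_V_pos by (simp add: field_simps)
qed

text \<open>\<open>Z0\<close> imposes its two conditions jointly for all pairs \<open>a\<close>,
  \<open>b\<close>; separating them relies on both sets being nonempty.\<close>

lemma Z0_iff:
  "f \<in> Z0 G A B S \<longleftrightarrow> f \<in> carrier G \<rightarrow>\<^sub>E S \<and>
    (\<forall>g\<in>carrier G. (\<forall>a\<in>A. \<not> viol_left f g a) \<and> (\<forall>b\<in>B. \<not> viol_right f g b))"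
  using A_nonempty B_nonempty unfolding Z0_def viol_left_def viol_right_def by blast

lemma Z0_iff_weight:
  "f \<in> Z0 G A B S \<longleftrightarrow> f \<in> carrier G \<rightarrow>\<^sub>E S \<and> violation_weight G A B f = 0"
proof -
  have 0: "edge_fraction X P v = 0 \<longleftrightarrow> (\<forall>x\<in>X. \<not> P v x)" if "finite X" for X v and P :: "'a \<Rightarrow> 'a \<Rightarrow> bool"
    using that by (auto simp: edge_fraction_def)
  have "violation_weight G A B f = 0 \<longleftrightarrow> (\<Sum>g\<in>carrier G. load f g) = 0"
    using L.card_V_pos by (simp add: sum_load)
  also have "\<dots> \<longleftrightarrow> (\<forall>g\<in>carrier G. load f g = 0)"
    using fin_G by (intro sum_nonneg_eq_0_iff load_nonneg)
  also have "\<dots> \<longleftrightarrow> (\<forall>g\<in>carrier G. (\<forall>a\<in>A. \<not> viol_left f g a) \<and> (\<forall>b\<in>B. \<not> viol_right f g b))"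
    by (simp add: load_def add_nonneg_eq_0_iff edge_fraction_bounds 0 L.fin_A R.fin_A)
  finally show ?thesis by (auto simp: Z0_iff)
qed

end

section \<open>Words on which the Correction Algorithm is stuck\<close>

lemma tensor_code_linear:
  fixes CA :: "('a \<Rightarrow> 'f::field) set" and CB :: "('b \<Rightarrow> 'f) set"
  assumes CA: "linear_code A CA" and CB: "linear_code B CB"
  shows "linear_code (A \<times> B) (tensor_code A B CA CB)"
proof -
  have "row B a (\<lambda>p\<in>A \<times> B. 0::'f) = (\<lambda>b\<in>B. 0::'f)" if "a \<in> A" for a
    using that by (auto simp: row_def fun_eq_iff)
  moreover have "col A b (\<lambda>p\<in>A \<times> B. 0::'f) = (\<lambda>a\<in>A. 0::'f)" if "b \<in> B" for b
    using that by (auto simp: col_def fun_eq_iff)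
  moreover have "row B a (\<lambda>p\<in>A \<times> B. u p + v p) = (\<lambda>b\<in>B. row B a u b + row B a v b)"
    if "a \<in> A" for a and u v :: "'a \<times> 'b \<Rightarrow> 'f" using that by (auto simp: row_def fun_eq_iff)
  moreover have "col A b (\<lambda>p\<in>A \<times> B. u p + v p) = (\<lambda>a\<in>A. col A b u a + col A b v a)"
    if "b \<in> B" for b and u v :: "'a \<times> 'b \<Rightarrow> 'f" using that by (auto simp: col_def fun_eq_iff)
  moreover have "row B a (\<lambda>p\<in>A \<times> B. c * u p) = (\<lambda>b\<in>B. c * row B a u b)"
    if "a \<in> A" for a c and u :: "'a \<times> 'b \<Rightarrow> 'f" using that by (auto simp: row_def fun_eq_iff)
  moreover have "col A b (\<lambda>p\<in>A \<times> B. c * u p) = (\<lambda>a\<in>A. c * col A b u a)"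
    if "b \<in> B" for b c and u :: "'a \<times> 'b \<Rightarrow> 'f" using that by (auto simp: col_def fun_eq_iff)
  ultimately show ?thesis
    using assms unfolding linear_code_def tensor_code_def by auto
qed

lemma linear_code_diff:
  assumes "linear_code I C" "u \<in> C" "v \<in> C"
  shows "(\<lambda>i\<in>I. u i - v i) \<in> C"
proof -
  have "(\<lambda>i\<in>I. -1 * v i) \<in> C" using assms unfolding linear_code_def by blast
  hence "(\<lambda>i\<in>I. u i + (\<lambda>i\<in>I. -1 * v i) i) \<in> C" using assms unfolding linear_code_def by blast
  moreover have "(\<lambda>i\<in>I. u i + (\<lambda>i\<in>I. -1 * v i) i) = (\<lambda>i\<in>I. u i - v i)" by auto
  ultimately show ?thesis by simp
qed

lemma hdist_triangle:
  assumes "finite I"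
  shows "hdist I f h \<le> hdist I f g + hdist I g h"
proof -
  have "card {i \<in> I. f i \<noteq> h i} \<le> card ({i \<in> I. f i \<noteq> g i} \<union> {i \<in> I. g i \<noteq> h i})"
    using assms by (intro card_mono) auto
  also have "\<dots> \<le> card {i \<in> I. f i \<noteq> g i} + card {i \<in> I. g i \<noteq> h i}" by (rule card_Un_le)
  finally have "real (card {i \<in> I. f i \<noteq> h i})
      \<le> real (card {i \<in> I. f i \<noteq> g i}) + real (card {i \<in> I. g i \<noteq> h i})" by linarith
  thus ?thesis by (simp add: hdist_def add_divide_distrib[symmetric] divide_right_mono)
qed

lemma hdist_commute: "hdist I f g = hdist I g f"
  by (simp add: hdist_def eq_commute)

lemma hdist_bounds: "finite I \<Longrightarrow> hdist I f g \<le> 1" "hdist I f g \<ge> 0"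
proof -
  assume "finite I"
  hence "card {i \<in> I. f i \<noteq> g i} \<le> card I" by (intro card_mono) auto
  thus "hdist I f g \<le> 1" by (auto simp: hdist_def divide_le_eq)
qed (simp add: hdist_def)

lemma hdist_code_le: "g \<in> C \<Longrightarrow> hdist_code I f C \<le> hdist I f g"
  unfolding hdist_code_def by (rule cINF_lower[OF bdd_belowI2[where m=0]]) (auto simp: hdist_bounds)

lemma hdist_code_lessD:
  assumes "hdist_code I f C < x" "C \<noteq> {}"
  shows "\<exists>g\<in>C. hdist I f g < x"
proof -
  have "bdd_below (hdist I f ` C)" by (rule bdd_belowI2[where m=0]) (simp add: hdist_bounds)
  thus ?thesis using assms cINF_less_iff[of C "hdist I f" x] by (simp add: hdist_code_def)
qed

lemma min_distD:
  assumes "min_dist I C \<ge> ereal \<epsilon>" "f \<in> C" "g \<in> C" "f \<noteq> g"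
  shows "\<epsilon> \<le> hdist I f g"
proof -
  have "min_dist I C \<le> ereal (hdist I f g)"
    unfolding min_dist_def using assms by (intro INF_lower2[of "(f, g)"]) auto
  with assms(1) show ?thesis using order_trans ereal_less_eq(3) by blast
qed

lemma edge_fraction_mono:
  assumes "finite A" "\<And>a. a \<in> A \<Longrightarrow> P v a \<Longrightarrow> Q v a"
  shows "edge_fraction A P v \<le> edge_fraction A Q v"
  unfolding edge_fraction_def using assms by (intro divide_right_mono of_nat_mono card_mono) auto

lemma edge_fraction_disj:
  assumes "finite A"
  shows "edge_fraction A (\<lambda>v a. P v a \<or> Q v a) v \<le> edge_fraction A P v + edge_fraction A Q v"
proof -
  have "{a \<in> A. P v a \<or> Q v a} = {a \<in> A. P v a} \<union> {a \<in> A. Q v a}" by auto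
  hence "card {a \<in> A. P v a \<or> Q v a} \<le> card {a \<in> A. P v a} + card {a \<in> A. Q v a}"
    using card_Un_le by metis
  hence "real (card {a \<in> A. P v a \<or> Q v a}) \<le> real (card {a \<in> A. P v a}) + real (card {a \<in> A. Q v a})"
    by linarith
  thus ?thesis by (simp add: edge_fraction_def add_divide_distrib[symmetric] divide_right_mono)
qed

locale tensor_square_complex = square_complex G A B for G (structure) and A B +
  fixes CA CB :: "('a \<Rightarrow> 'f::{field, finite}) set" and \<epsilon> :: real
  assumes CA_linear: "linear_code A CA" and CB_linear: "linear_code B CB"
    and \<epsilon>_pos: "0 < \<epsilon>" and \<epsilon>_le_1: "\<epsilon> \<le> 1"
    and CA_dist: "min_dist A CA \<ge> ereal \<epsilon>" and CB_dist: "min_dist B CB \<ge> ereal \<epsilon>"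
    and agreement: "agreement_testable A B CA CB \<epsilon>"
    and L_expander: "expander (carrier G) (cay_left_edges G A) (\<epsilon>\<^sup>2 / 2500)"
    and R_expander: "expander (carrier G) (cay_right_edges G B) (\<epsilon>\<^sup>2 / 2500)"
begin

abbreviation "S \<equiv> tensor_code A B CA CB"
abbreviation "Z \<equiv> Z0 G A B S"
abbreviation "W \<equiv> violation_weight G A B"
definition "M = 250000 / \<epsilon> ^ 3 + 4800 * max (real (card A)) (real (card B)) / \<epsilon>"

sublocale LE: expanding_graph "carrier G" A "\<lambda>a g. a \<otimes> g" "\<lambda>a. inv a" "\<epsilon>\<^sup>2 / 2500"
  using L.expanding_graphI L_expander by (simp add: left_edges)

sublocale RE: expanding_graph "carrier G" B "\<lambda>b g. g \<otimes> b" "\<lambda>b. inv b" "\<epsilon>\<^sup>2 / 2500"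
  using R.expanding_graphI R_expander by (simp add: right_edges)

lemma S_linear: "linear_code (A \<times> B) S"
  by (rule tensor_code_linear[OF CA_linear CB_linear])

lemma row_in_CB: "m \<in> S \<Longrightarrow> a \<in> A \<Longrightarrow> row B a m \<in> CB"
  by (simp add: tensor_code_def)

lemma col_in_CA: "m \<in> S \<Longrightarrow> b \<in> B \<Longrightarrow> col A b m \<in> CA"
  by (simp add: tensor_code_def)

lemma S_extensional: "m \<in> S \<Longrightarrow> m \<in> extensional (A \<times> B)"
  by (auto simp: tensor_code_def PiE_def)

lemma zero_in_Z: "(\<lambda>g\<in>carrier G. \<lambda>p\<in>A \<times> B. 0) \<in> Z"
proof -
  have "(\<lambda>p\<in>A \<times> B. 0) \<in> S" using S_linear by (simp add: linear_code_def)
  thus ?thesis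
    by (auto simp: Z0_iff viol_left_def viol_right_def row_def col_def fun_eq_iff)
qed

lemma M_bounds: "250000 / \<epsilon> ^ 3 \<le> M" "4800 * real (card A) / \<epsilon> \<le> M" "4800 * real (card B) / \<epsilon> \<le> M"
  "M > 0" "4800 / \<epsilon> \<le> M"
proof -
  have p: "250000 / \<epsilon> ^ 3 > 0" using \<epsilon>_pos by simp
  have q: "4800 * max (real (card A)) (real (card B)) / \<epsilon> \<ge> 0" using \<epsilon>_pos by simp
  show "250000 / \<epsilon> ^ 3 \<le> M" using q by (simp add: M_def)
  show "M > 0" unfolding M_def by (rule add_pos_nonneg[OF p q])
  have "4800 * real (card A) / \<epsilon> \<le> 4800 * max (real (card A)) (real (card B)) / \<epsilon>"
    "4800 * real (card B) / \<epsilon> \<le> 4800 * max (real (card A)) (real (card B)) / \<epsilon>"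
    using \<epsilon>_pos by (auto intro!: divide_right_mono)
  with p show A: "4800 * real (card A) / \<epsilon> \<le> M" and "4800 * real (card B) / \<epsilon> \<le> M"
    unfolding M_def by linarith+
  have "4800 * 1 / \<epsilon> \<le> 4800 * real (card A) / \<epsilon>"
    using \<epsilon>_pos L.card_A_pos by (intro divide_right_mono mult_left_mono) auto
  with A show "4800 / \<epsilon> \<le> M" by simp
qed

text \<open>
  In the square \<open>g, ag, gb, agb\<close>, if only the edge \<open>{g, ag}\<close> were violated then the four
  values would agree on the entry belonging to the square.
\<close>

lemma viol_left_opposite:
  assumes f: "f \<in> carrier G \<rightarrow>\<^sub>E S" and g: "g \<in> carrier G" and a: "a \<in> A" and v: "viol_left f g a"
  shows "\<epsilon> \<le> edge_fraction B (\<lambda>g b. viol_left f (g \<otimes> b) a) g + load f g + load f (a \<otimes> g)"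
proof -
  let ?u = "row B a (f g)" and ?u' = "row B (inv a) (f (a \<otimes> g))"
  have "f g \<in> S" "f (a \<otimes> g) \<in> S" using f g a by auto
  hence "\<epsilon> \<le> hdist B ?u ?u'"
    using v a by (intro min_distD[OF CB_dist] row_in_CB) (auto simp: viol_left_def)
  also have "\<dots> = edge_fraction B (\<lambda>g b. ?u b \<noteq> ?u' b) g"
    by (simp add: hdist_def edge_fraction_def)
  also have "\<dots> \<le> edge_fraction B (\<lambda>h b. (viol_left f (g \<otimes> b) a \<or> viol_right f g b)
      \<or> viol_right f (a \<otimes> g) b) g"
  proof (rule edge_fraction_mono[OF R.fin_A])
    fix b assume b: "b \<in> B" and ne: "?u b \<noteq> ?u' b"
    show "(viol_left f (g \<otimes> b) a \<or> viol_right f g b) \<or> viol_right f (a \<otimes> g) b"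
    proof (rule ccontr)
      assume *: "\<not> ?thesis"
      have "f g (a, b) = f (g \<otimes> b) (a, inv b)"
        using * a b by (auto simp: viol_right_def col_def dest: fun_cong[of _ _ a])
      also have "\<dots> = f (a \<otimes> (g \<otimes> b)) (inv a, inv b)"
        using * a b by (auto simp: viol_left_def row_def dest: fun_cong[of _ _ "inv b"])
      also have "\<dots> = f (a \<otimes> g) (inv a, b)"
        using * a b g by (auto simp: viol_right_def col_def m_assoc dest: fun_cong[of _ _ "inv a"])
      finally show False using ne b by (simp add: row_def)
    qed
  qed
  also have "\<dots> \<le> (edge_fraction B (\<lambda>g b. viol_left f (g \<otimes> b) a) g + edge_fraction B (viol_right f) g)
      + edge_fraction B (viol_right f) (a \<otimes> g)"
    using edge_fraction_disj[OF R.fin_A, of "\<lambda>h b. viol_left f (g \<otimes> b) a \<or> viol_right f g b"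
        "\<lambda>h b. viol_right f (a \<otimes> g) b" g]
      edge_fraction_disj[OF R.fin_A, of "\<lambda>h b. viol_left f (g \<otimes> b) a" "\<lambda>h b. viol_right f g b" g]
    by (simp add: edge_fraction_def)
  finally show ?thesis
    using edge_fraction_bounds(1)[of A "viol_left f" g]
      edge_fraction_bounds(1)[of A "viol_left f" "a \<otimes> g"] unfolding load_def by linarith
qed

lemma viol_right_opposite:
  assumes f: "f \<in> carrier G \<rightarrow>\<^sub>E S" and g: "g \<in> carrier G" and b: "b \<in> B" and v: "viol_right f g b"
  shows "\<epsilon> \<le> edge_fraction A (\<lambda>g a. viol_right f (a \<otimes> g) b) g + load f g + load f (g \<otimes> b)"
proof -
  let ?u = "col A b (f g)" and ?u' = "col A (inv b) (f (g \<otimes> b))"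
  have "f g \<in> S" "f (g \<otimes> b) \<in> S" using f g b by auto
  hence "\<epsilon> \<le> hdist A ?u ?u'"
    using v b by (intro min_distD[OF CA_dist] col_in_CA) (auto simp: viol_right_def)
  also have "\<dots> = edge_fraction A (\<lambda>g a. ?u a \<noteq> ?u' a) g"
    by (simp add: hdist_def edge_fraction_def)
  also have "\<dots> \<le> edge_fraction A (\<lambda>h a. (viol_right f (a \<otimes> g) b \<or> viol_left f g a)
      \<or> viol_left f (g \<otimes> b) a) g"
  proof (rule edge_fraction_mono[OF L.fin_A])
    fix a assume a: "a \<in> A" and ne: "?u a \<noteq> ?u' a"
    show "(viol_right f (a \<otimes> g) b \<or> viol_left f g a) \<or> viol_left f (g \<otimes> b) a"
    proof (rule ccontr)
      assume *: "\<not> ?thesis"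
      have "f g (a, b) = f (a \<otimes> g) (inv a, b)"
        using * a b by (auto simp: viol_left_def row_def dest: fun_cong[of _ _ b])
      also have "\<dots> = f (a \<otimes> g \<otimes> b) (inv a, inv b)"
        using * a b by (auto simp: viol_right_def col_def dest: fun_cong[of _ _ "inv a"])
      also have "\<dots> = f (g \<otimes> b) (a, inv b)"
        using * a b g by (auto simp: viol_left_def row_def m_assoc dest: fun_cong[of _ _ "inv b"])
      finally show False using ne a by (simp add: col_def)
    qed
  qed
  also have "\<dots> \<le> (edge_fraction A (\<lambda>g a. viol_right f (a \<otimes> g) b) g + edge_fraction A (viol_left f) g)
      + edge_fraction A (viol_left f) (g \<otimes> b)"
    using edge_fraction_disj[OF L.fin_A, of "\<lambda>h a. viol_right f (a \<otimes> g) b \<or> viol_left f g a"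
        "\<lambda>h a. viol_left f (g \<otimes> b) a" g]
      edge_fraction_disj[OF L.fin_A, of "\<lambda>h a. viol_right f (a \<otimes> g) b" "\<lambda>h a. viol_left f g a" g]
    by (simp add: edge_fraction_def)
  finally show ?thesis
    using edge_fraction_bounds(1)[of B "viol_right f" g]
      edge_fraction_bounds(1)[of B "viol_right f" "g \<otimes> b"] unfolding load_def by linarith
qed

abbreviation "stuck f \<equiv> \<not> (\<exists>f'. correction_step G A B S (\<epsilon> / 100) f f')"

text \<open>Any replacement value \<open>m\<close> is reached by adding \<open>m - f g\<close>,
  which lies in the linear code \<open>S\<close>. It is therefore a move the algorithm could make,
  and being stuck limits the gain.\<close>

lemma stuck_load_update:
  assumes f: "f \<in> carrier G \<rightarrow>\<^sub>E S" and "stuck f" and g: "g \<in> carrier G" and m: "m \<in> S"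
  shows "load f g - \<epsilon> / 100 \<le> load (f(g := m)) g"
proof -
  let ?d = "\<lambda>p\<in>A \<times> B. m p - f g p"
  have "f g \<in> S" using f g by auto
  with m have d: "?d \<in> S" by (rule linear_code_diff[OF S_linear])
  have "m = (\<lambda>p\<in>A \<times> B. f g p + ?d p)"
    using S_extensional[OF m] by (auto simp: fun_eq_iff extensional_def)
  hence "f(g := m) = f(g := (\<lambda>p\<in>A \<times> B. f g p + ?d p))" by simp
  hence "\<not> W (f(g := m)) < W f - \<epsilon> / 100 / n"
    using \<open>stuck f\<close> d g unfolding correction_step_def by blast
  hence "(load f g - load (f(g := m)) g) / n \<le> \<epsilon> / 100 / n"
    using violation_weight_change[OF g, of f m] by linarith
  from mult_right_mono[OF this, of n] show ?thesis using L.card_V_pos by simp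
qed

text \<open>
  The rows that the neighbours \<open>ag\<close> and the columns that the neighbours \<open>gb\<close> prescribe at
  \<open>g\<close> form two matrices, to which agreement testability is applied.
\<close>

lemma stuck_load_le:
  assumes f: "f \<in> carrier G \<rightarrow>\<^sub>E S" and "stuck f" and g: "g \<in> carrier G"
  shows "\<epsilon> / 2 * (load f g - \<epsilon> / 100)
    \<le> L.avg (edge_fraction B (viol_right f)) g + R.avg (edge_fraction A (viol_left f)) g"
proof -
  have fS: "f h \<in> S" if "h \<in> carrier G" for h using f that by auto
  define m1 where "m1 = (\<lambda>(a, b)\<in>A \<times> B. f (g \<otimes> b) (a, inv b))"
  define m2 where "m2 = (\<lambda>(a, b)\<in>A \<times> B. f (a \<otimes> g) (inv a, b))"
  have col1: "col A b m1 = col A (inv b) (f (g \<otimes> b))" if "b \<in> B" for b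
    using that by (auto simp: col_def m1_def fun_eq_iff)
  have row2: "row B a m2 = row B (inv a) (f (a \<otimes> g))" if "a \<in> A" for a
    using that by (auto simp: row_def m2_def fun_eq_iff)
  have "m1 \<in> tensor_code A B CA (B \<rightarrow>\<^sub>E UNIV)"
    using g col_in_CA[OF fS, of "g \<otimes> b" "inv b" for b]
    by (simp add: tensor_code_def col1) (simp add: m1_def row_def)
  moreover have "m2 \<in> tensor_code A B (A \<rightarrow>\<^sub>E UNIV) CB"
    using g row_in_CB[OF fS, of "a \<otimes> g" "inv a" for a]
    by (simp add: tensor_code_def row2) (simp add: m2_def col_def)
  ultimately obtain m where m: "m \<in> S" and le:
    "\<epsilon> * (real (card {a \<in> A. row B a m2 \<noteq> row B a m}) / (2 * real (card A))
        + real (card {b \<in> B. col A b m1 \<noteq> col A b m}) / (2 * real (card B)))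
     \<le> real (card {(a, b). a \<in> A \<and> b \<in> B \<and> m1 (a, b) \<noteq> m2 (a, b)}) / (real (card A) * real (card B))"
    using agreement unfolding agreement_testable_def by blast
  \<comment> \<open>Once the value at \<open>g\<close> is \<open>m\<close>, the neighbours being
    different from \<open>g\<close> and unchanged, the disagreements with \<open>m\<close> are
    exactly the violated edges at \<open>g\<close>. The bracket in agreement testability becomes
    half the new load.\<close>
  have "{a \<in> A. row B a m2 \<noteq> row B a m} = {a \<in> A. viol_left (f(g := m)) g a}"
    "{b \<in> B. col A b m1 \<noteq> col A b m} = {b \<in> B. viol_right (f(g := m)) g b}"
    using L.no_loops R.no_loops g by (auto simp: viol_left_def viol_right_def row2 col1)
  hence load_m: "real (card {a \<in> A. row B a m2 \<noteq> row B a m}) / (2 * real (card A))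
      + real (card {b \<in> B. col A b m1 \<noteq> col A b m}) / (2 * real (card B)) = load (f(g := m)) g / 2"
    by (simp add: load_def edge_fraction_def add_divide_distrib)
  define D1 where "D1 = Sigma A (\<lambda>a. {b \<in> B. viol_right f (a \<otimes> g) b})"
  define D2 where "D2 = Sigma B (\<lambda>b. {a \<in> A. viol_left f (g \<otimes> b) a})"
  have fin: "finite D1" "finite D2" using L.fin_A R.fin_A by (auto simp: D1_def D2_def)
  \<comment> \<open>The entries of \<open>m1\<close> and \<open>m2\<close> at (a, b) come from gb
    and ag; both equal an entry at agb unless {ag, agb} or {gb, agb} is violated. These are the two
    edges of the square that avoid g.\<close>
  have "{(a, b). a \<in> A \<and> b \<in> B \<and> m1 (a, b) \<noteq> m2 (a, b)} \<subseteq> D1 \<union> prod.swap ` D2"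
  proof safe
    fix a b assume a: "a \<in> A" and b: "b \<in> B" and ne: "m1 (a, b) \<noteq> m2 (a, b)"
      and nD2: "(a, b) \<notin> prod.swap ` D2"
    show "(a, b) \<in> D1"
    proof (rule ccontr)
      assume nD1: "(a, b) \<notin> D1"
      have R: "\<not> viol_right f (a \<otimes> g) b" using nD1 a b by (auto simp: D1_def)
      have L: "\<not> viol_left f (g \<otimes> b) a" using nD2 a b by (force simp: D2_def image_iff)
      have "m1 (a, b) = f (g \<otimes> b) (a, inv b)" using a b by (simp add: m1_def)
      also have "\<dots> = f (a \<otimes> (g \<otimes> b)) (inv a, inv b)"
        using L a b by (auto simp: viol_left_def row_def dest: fun_cong[of _ _ "inv b"])
      also have "\<dots> = f (a \<otimes> g) (inv a, b)"
        using R a b g by (auto simp: viol_right_def col_def m_assoc dest: fun_cong[of _ _ "inv a"])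
      also have "\<dots> = m2 (a, b)" using a b by (simp add: m2_def)
      finally show False using ne by simp
    qed
  qed
  hence "card {(a, b). a \<in> A \<and> b \<in> B \<and> m1 (a, b) \<noteq> m2 (a, b)} \<le> card (D1 \<union> prod.swap ` D2)"
    using fin by (intro card_mono) auto
  also have "\<dots> \<le> card D1 + card D2"
    using card_Un_le[of D1 "prod.swap ` D2"] card_image_le[OF fin(2), of prod.swap] by linarith
  finally have "real (card {(a, b). a \<in> A \<and> b \<in> B \<and> m1 (a, b) \<noteq> m2 (a, b)})
      \<le> real (card D1) + real (card D2)" by linarith
  hence "real (card {(a, b). a \<in> A \<and> b \<in> B \<and> m1 (a, b) \<noteq> m2 (a, b)}) / (real (card A) * real (card B))
      \<le> (real (card D1) + real (card D2)) / (real (card A) * real (card B))"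
    by (intro divide_right_mono) auto
  also have "\<dots> = L.avg (edge_fraction B (viol_right f)) g + R.avg (edge_fraction A (viol_left f)) g"
    using L.fin_A R.fin_A
    by (simp add: D1_def D2_def L.avg_def R.avg_def edge_fraction_def add_divide_distrib
        sum_divide_distrib[symmetric] mult.commute)
  finally have "\<epsilon> * (load (f(g := m)) g / 2)
      \<le> L.avg (edge_fraction B (viol_right f)) g + R.avg (edge_fraction A (viol_left f)) g"
    using le unfolding load_m by linarith
  moreover have "\<epsilon> / 2 * (load f g - \<epsilon> / 100) \<le> \<epsilon> / 2 * load (f(g := m)) g"
    using stuck_load_update[OF f \<open>stuck f\<close> g m] \<epsilon>_pos by (intro mult_left_mono) auto
  ultimately show ?thesis by simp
qed

text \<open>The assumptions of \<open>load_eq_zeroI\<close> are met with \<open>\<alpha>\<close>,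
  \<open>\<beta>\<close> the left and right violated fractions: being stuck gives the local
  inequality, and \<open>bad_edges_meet_heavy_vertices\<close>, used once in each direction, gives
  the two heavy-vertex bounds.\<close>

lemma stuck_light_is_codeword:
  assumes f: "f \<in> carrier G \<rightarrow>\<^sub>E S" and "stuck f" and light: "W f < 2 / M"
  shows "f \<in> Z"
proof -
  let ?\<alpha> = "edge_fraction A (viol_left f)" and ?\<beta> = "edge_fraction B (viol_right f)"
  have "2 * n * W f \<le> 2 * n * (2 / M)"
    using light by (intro mult_left_mono) auto
  hence "2 * n * W f \<le> n * (4 / M)" by (simp add: mult.commute)
  hence load_le: "(\<Sum>g\<in>carrier G. load f g) \<le> n * (4 / M)" unfolding sum_load .
  \<comment> \<open>The mean load is at most \<open>4 / M\<close>. With \<open>c\<close> labels of a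
    kind, one violated label contributes at least \<open>1 / c\<close> to a load, so it is violated
    at a share of at most \<open>4 * c / M\<close> of the vertices.\<close>
  have small: "real c * (4 / M) \<le> \<epsilon> / 1200" if "4800 * real c / \<epsilon> \<le> M" for c
    using that M_bounds(4) \<epsilon>_pos by (simp add: field_simps)
  have \<epsilon>2: "\<epsilon>\<^sup>2 \<le> \<epsilon>" using \<epsilon>_pos \<epsilon>_le_1 by (simp add: power2_eq_square mult_left_le)
  have \<xi>: "\<epsilon> / 1200 + \<epsilon>\<^sup>2 / 2500 \<le> (\<epsilon> - 2 * (\<epsilon> / 20)) / 100" using \<epsilon>2 \<epsilon>_pos by simp
  have left: "real (card {v \<in> carrier G. viol_left f v a}) \<le> \<epsilon> / 1200 * n" if a: "a \<in> A" for a
  proof -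
    have "real (card {v \<in> carrier G. viol_left f v a}) = (\<Sum>v\<in>carrier G. of_bool (viol_left f v a))"
      using fin_G by (simp add: Int_def)
    also have "\<dots> \<le> (\<Sum>v\<in>carrier G. real (card A) * load f v)"
    proof (intro sum_mono)
      fix v
      have "of_bool (viol_left f v a) \<le> (\<Sum>a\<in>A. of_bool (viol_left f v a) :: real)"
        using a L.fin_A by (intro member_le_sum) auto
      also have "\<dots> = real (card A) * ?\<alpha> v"
        using L.card_A_pos L.fin_A by (simp add: edge_fraction_altdef del: sum_of_bool_eq)
      also have "\<dots> \<le> real (card A) * load f v"
        by (intro mult_left_mono) (auto simp: load_def edge_fraction_bounds)
      finally show "of_bool (viol_left f v a) \<le> real (card A) * load f v" .
    qed
    also have "\<dots> \<le> real (card A) * (n * (4 / M))"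
      unfolding sum_distrib_left[symmetric] using load_le by (intro mult_left_mono) auto
    also have "\<dots> = real (card A) * (4 / M) * n" by simp
    also have "\<dots> \<le> \<epsilon> / 1200 * n" by (intro mult_right_mono small M_bounds) auto
    finally show ?thesis .
  qed
  have right: "real (card {v \<in> carrier G. viol_right f v b}) \<le> \<epsilon> / 1200 * n" if b: "b \<in> B" for b
  proof -
    have "real (card {v \<in> carrier G. viol_right f v b}) = (\<Sum>v\<in>carrier G. of_bool (viol_right f v b))"
      using fin_G by (simp add: Int_def)
    also have "\<dots> \<le> (\<Sum>v\<in>carrier G. real (card B) * load f v)"
    proof (intro sum_mono)
      fix v
      have "of_bool (viol_right f v b) \<le> (\<Sum>b\<in>B. of_bool (viol_right f v b) :: real)"
        using b R.fin_A by (intro member_le_sum) auto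
      also have "\<dots> = real (card B) * ?\<beta> v"
        using R.card_A_pos R.fin_A by (simp add: edge_fraction_altdef del: sum_of_bool_eq)
      also have "\<dots> \<le> real (card B) * load f v"
        by (intro mult_left_mono) (auto simp: load_def edge_fraction_bounds)
      finally show "of_bool (viol_right f v b) \<le> real (card B) * load f v" .
    qed
    also have "\<dots> \<le> real (card B) * (n * (4 / M))"
      unfolding sum_distrib_left[symmetric] using load_le by (intro mult_left_mono) auto
    also have "\<dots> = real (card B) * (4 / M) * n" by simp
    also have "\<dots> \<le> \<epsilon> / 1200 * n" by (intro mult_right_mono small M_bounds) auto
    finally show ?thesis .
  qed
  have "0.99 * (\<Sum>v\<in>carrier G. ?\<alpha> v)
      \<le> 2 * (\<Sum>v\<in>carrier G. of_bool (\<epsilon> / 20 \<le> load f v) * ?\<alpha> v)"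
    by (rule bad_edges_meet_heavy_vertices[OF L.labelled_graph_axioms RE.expanding_graph_axioms,
          where \<epsilon>=\<epsilon> and \<xi>="\<epsilon> / 1200"])
       (use viol_left_sym viol_left_opposite[OF f] left \<epsilon>_pos \<xi> in auto)
  moreover have "0.99 * (\<Sum>v\<in>carrier G. ?\<beta> v)
      \<le> 2 * (\<Sum>v\<in>carrier G. of_bool (\<epsilon> / 20 \<le> load f v) * ?\<beta> v)"
    by (rule bad_edges_meet_heavy_vertices[OF R.labelled_graph_axioms LE.expanding_graph_axioms,
          where \<epsilon>=\<epsilon> and \<xi>="\<epsilon> / 1200"])
       (use viol_right_sym viol_right_opposite[OF f] right \<epsilon>_pos \<xi> in auto)
  moreover have "(\<Sum>v\<in>carrier G. load f v) \<le> \<epsilon> ^ 3 / 31250 * n"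
  proof -
    have "4 / M \<le> \<epsilon> ^ 3 / 31250" using M_bounds(1,4) \<epsilon>_pos by (simp add: field_simps)
    hence "n * (4 / M) \<le> n * (\<epsilon> ^ 3 / 31250)" by (intro mult_left_mono) auto
    from order_trans[OF load_le this] show ?thesis by (simp only: mult.commute[of n])
  qed
  ultimately have "(\<Sum>v\<in>carrier G. load f v) = 0"
    unfolding load_def using stuck_load_le[OF f \<open>stuck f\<close>] \<epsilon>_pos \<epsilon>_le_1
    by (intro load_eq_zeroI[OF LE.expanding_graph_axioms RE.expanding_graph_axioms, where \<epsilon>=\<epsilon>])
       (auto simp: edge_fraction_bounds load_def)
  thus ?thesis using f L.card_V_pos by (simp add: Z0_iff_weight sum_load)
qed

end

section \<open>The rate\<close>

lemma linear_code_sum: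
  assumes C: "linear_code I C" and J: "finite J" and e: "\<And>j. j \<in> J \<Longrightarrow> e j \<in> C"
  shows "(\<lambda>i\<in>I. \<Sum>j\<in>J. u j * e j i) \<in> C"
  using J e
proof (induction J rule: finite_induct)
  case empty
  thus ?case using C unfolding linear_code_def by (simp only: sum.empty)
next
  case (insert k J)
  have "(\<lambda>i\<in>I. u k * e k i) \<in> C" "(\<lambda>i\<in>I. \<Sum>j\<in>J. u j * e j i) \<in> C"
    using C insert unfolding linear_code_def by blast+
  hence "(\<lambda>i\<in>I. (\<lambda>i\<in>I. u k * e k i) i + (\<lambda>i\<in>I. \<Sum>j\<in>J. u j * e j i) i) \<in> C"
    using C unfolding linear_code_def by blast
  moreover have "(\<lambda>i\<in>I. (\<lambda>i\<in>I. u k * e k i) i + (\<lambda>i\<in>I. \<Sum>j\<in>J. u j * e j i) i)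
      = (\<lambda>i\<in>I. \<Sum>j\<in>insert k J. u j * e j i)" using insert by auto
  ultimately show ?case by (simp only:)
qed

text \<open>
  An information set is a maximal set of coordinates admitting a dual family of codewords:
  a nonzero codeword vanishing on \<open>J\<close> would enlarge it.
\<close>

lemma information_set:
  fixes C :: "('i \<Rightarrow> 'f::field) set"
  assumes I: "finite I" and C: "linear_code I C"
  obtains J e where "J \<subseteq> I" "\<And>i. i \<in> J \<Longrightarrow> e i \<in> C"
    "\<And>i j. i \<in> J \<Longrightarrow> j \<in> J \<Longrightarrow> e i j = of_bool (i = j)" "inj_on (\<lambda>c. restrict c J) C"
proof -
  define P where "P J \<longleftrightarrow> J \<subseteq> I \<and> (\<exists>e. (\<forall>i\<in>J. e i \<in> C) \<and> (\<forall>i\<in>J. \<forall>j\<in>J. e i j = of_bool (i = j)))"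
    for J
  have "P {}" by (simp add: P_def)
  moreover have "\<forall>J. P J \<longrightarrow> card J < Suc (card I)"
    using I by (auto simp: P_def less_Suc_eq_le intro: card_mono)
  ultimately obtain J where J: "P J" "\<And>K. P K \<Longrightarrow> card K \<le> card J"
    using ex_has_greatest_nat[of P "{}" card "Suc (card I)"] by blast
  then obtain e where JI: "J \<subseteq> I" and eC: "\<And>i. i \<in> J \<Longrightarrow> e i \<in> C"
    and dual: "\<And>i j. i \<in> J \<Longrightarrow> j \<in> J \<Longrightarrow> e i j = of_bool (i = j)"
    unfolding P_def by blast
  have finJ: "finite J" using JI I finite_subset by blast
  have scale: "(\<lambda>i\<in>I. x * u i) \<in> C" if "u \<in> C" for x u
    using C that unfolding linear_code_def by blast
  have vanish: "c x = 0" if c: "c \<in> C" "\<And>j. j \<in> J \<Longrightarrow> c j = 0" and x: "x \<in> I" for c x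
  proof (rule ccontr)
    assume nz: "c x \<noteq> 0"
    hence xJ: "x \<notin> J" using c by auto
    define d where "d = (\<lambda>i\<in>I. inverse (c x) * c i)"
    have d: "d \<in> C" unfolding d_def by (rule scale[OF c(1)])
    have dx: "d x = 1" using nz x by (simp add: d_def)
    have dJ: "d j = 0" if "j \<in> J" for j using that JI c(2) by (auto simp: d_def)
    \<comment> \<open>One step of Gaussian elimination: \<open>d\<close> is 1 at \<open>x\<close>
      and 0 on \<open>J\<close>, and subtracting a multiple of \<open>d\<close> makes each old
      codeword vanish at \<open>x\<close> without changing it on \<open>J\<close>.\<close>
    define e' where "e' i = (if i = x then d else (\<lambda>j\<in>I. e i j - (\<lambda>j\<in>I. e i x * d j) j))" for i
    have "P (insert x J)"
      unfolding P_def
    proof (intro conjI exI[of _ e'] ballI)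
      show "insert x J \<subseteq> I" using JI x by auto
      show "e' i \<in> C" if "i \<in> insert x J" for i
        using that d eC linear_code_diff[OF C eC scale[OF d]] by (auto simp: e'_def)
      show "e' i j = of_bool (i = j)" if "i \<in> insert x J" "j \<in> insert x J" for i j
        using that xJ dx dJ dual JI x by (auto simp: e'_def)
    qed
    from J(2)[OF this] xJ finJ show False by simp
  qed
  have "inj_on (\<lambda>c. restrict c J) C"
  proof (rule inj_onI)
    fix c d assume cd: "c \<in> C" "d \<in> C" "restrict c J = restrict d J"
    have ext: "c \<in> extensional I" "d \<in> extensional I"
      using C cd by (auto simp: linear_code_def PiE_def)
    show "c = d"
    proof (rule extensionalityI[OF ext])
      fix x assume x: "x \<in> I"
      have "(\<lambda>i\<in>I. c i - d i) x = 0"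
      proof (rule vanish[OF linear_code_diff[OF C cd(1,2)] _ x])
        fix j assume "j \<in> J"
        thus "(\<lambda>i\<in>I. c i - d i) j = 0" using fun_cong[OF cd(3), of j] JI by auto
      qed
      thus "c x = d x" using x by simp
    qed
  qed
  with JI eC dual show ?thesis by (rule that)
qed

text \<open>The products of dual families on information sets \<open>I\<close> and \<open>J\<close>
  are a dual family on \<open>I \<times> J\<close> inside the tensor code, so entries on
  \<open>I \<times> J\<close> can be prescribed freely. The exponents \<open>k\<close> and
  \<open>l\<close> take the place of dimensions.\<close>

lemma card_tensor_code_ge:
  fixes CA :: "('a \<Rightarrow> 'f::{field, finite}) set" and CB :: "('b \<Rightarrow> 'f) set"
  assumes fin: "finite A" "finite B" and CA: "linear_code A CA" and CB: "linear_code B CB"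
  obtains k l where "card CA \<le> CARD('f) ^ k" "card CB \<le> CARD('f) ^ l"
    "CARD('f) ^ (k * l) \<le> card (tensor_code A B CA CB)"
proof -
  obtain I e where I: "I \<subseteq> A" "\<And>i. i \<in> I \<Longrightarrow> e i \<in> CA"
    "\<And>i j. i \<in> I \<Longrightarrow> j \<in> I \<Longrightarrow> e i j = of_bool (i = j)" "inj_on (\<lambda>c. restrict c I) CA"
    using information_set[OF fin(1) CA] by blast
  obtain J d where J: "J \<subseteq> B" "\<And>i. i \<in> J \<Longrightarrow> d i \<in> CB"
    "\<And>i j. i \<in> J \<Longrightarrow> j \<in> J \<Longrightarrow> d i j = of_bool (i = j)" "inj_on (\<lambda>c. restrict c J) CB"
    using information_set[OF fin(2) CB] by blast
  have finI: "finite I" and finJ: "finite J" using I J fin finite_subset by blast+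
  have card_fun: "card (K \<rightarrow>\<^sub>E (UNIV :: 'f set)) = CARD('f) ^ card K" if "finite K" for K :: "'k set"
    using that by (simp add: card_PiE)
  have "card CA \<le> card (I \<rightarrow>\<^sub>E (UNIV :: 'f set))"
    using finI by (intro card_inj_on_le[OF I(4)]) (auto intro: finite_PiE)
  hence kA: "card CA \<le> CARD('f) ^ card I" by (simp add: card_fun finI)
  have "card CB \<le> card (J \<rightarrow>\<^sub>E (UNIV :: 'f set))"
    using finJ by (intro card_inj_on_le[OF J(4)]) (auto intro: finite_PiE)
  hence kB: "card CB \<le> CARD('f) ^ card J" by (simp add: card_fun finJ)
  define t where "t u = (\<lambda>(a, b)\<in>A \<times> B. \<Sum>i\<in>I. \<Sum>j\<in>J. u (i, j) * e i a * d j b)" for u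
  have "t u \<in> tensor_code A B CA CB" for u
  proof -
    have "row B a (t u) = (\<lambda>b\<in>B. \<Sum>j\<in>J. (\<Sum>i\<in>I. u (i, j) * e i a) * d j b)" if "a \<in> A" for a
      using that by (auto simp: row_def t_def fun_eq_iff sum_distrib_right intro: sum.swap)
    moreover have "col A b (t u) = (\<lambda>a\<in>A. \<Sum>i\<in>I. (\<Sum>j\<in>J. u (i, j) * d j b) * e i a)" if "b \<in> B" for b
      using that by (auto simp: col_def t_def fun_eq_iff sum_distrib_left mult_ac)
    ultimately show ?thesis
      using linear_code_sum[OF CA finI I(2)] linear_code_sum[OF CB finJ J(2)]
      by (simp add: tensor_code_def) (simp add: t_def)
  qed
  moreover have t_eval: "t u (i, j) = u (i, j)" if "i \<in> I" "j \<in> J" for u i j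
  proof -
    have "t u (i, j) = (\<Sum>i'\<in>I. \<Sum>j'\<in>J. if j' = j then (if i' = i then u (i', j') else 0) else 0)"
      using that I J by (auto simp: t_def intro!: sum.cong)
    thus ?thesis using that finI finJ by simp
  qed
  have "inj_on t (I \<times> J \<rightarrow>\<^sub>E UNIV)"
  proof (rule inj_onI)
    fix u v assume uv: "u \<in> I \<times> J \<rightarrow>\<^sub>E UNIV" "v \<in> I \<times> J \<rightarrow>\<^sub>E UNIV" "t u = t v"
    show "u = v"
    proof (rule PiE_ext[OF uv(1,2)])
      fix p assume "p \<in> I \<times> J"
      thus "u p = v p" using t_eval[of "fst p" "snd p"] uv(3) by (metis mem_Times_iff prod.collapse)
    qed
  qed
  moreover have "finite (tensor_code A B CA CB)"
    by (rule finite_subset[of _ "A \<times> B \<rightarrow>\<^sub>E UNIV"]) (auto simp: tensor_code_def fin intro: finite_PiE)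
  ultimately have "card (I \<times> J \<rightarrow>\<^sub>E (UNIV :: 'f set)) \<le> card (tensor_code A B CA CB)"
    by (intro card_inj_on_le[of t]) auto
  hence "CARD('f) ^ (card I * card J) \<le> card (tensor_code A B CA CB)"
    using card_fun[of "I \<times> J"] finI finJ by (simp add: card_cartesian_product)
  with kA kB show ?thesis by (rule that)
qed

lemma card_le_fibres:
  assumes "finite P" "finite X" "f ` P \<subseteq> X" and k: "\<And>x. x \<in> P \<Longrightarrow> card {y \<in> P. f y = f x} \<le> k"
  shows "card P \<le> k * card X"
proof -
  have "card P = (\<Sum>z\<in>f ` P. card {y \<in> P. f y = z})"
    using sum.image_gen[OF assms(1), of "\<lambda>_. 1::nat" f] by simp
  also have "\<dots> \<le> (\<Sum>z\<in>f ` P. k)" using k by (intro sum_mono) auto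
  also have "\<dots> \<le> k * card X" using assms by (simp add: card_mono)
  finally show ?thesis .
qed

context tensor_square_complex
begin

text \<open>The orbit of a flag (a square with a marked corner) under moving the corner along a left
  or a right edge. Taking flags rather than vertices makes its invariance under these moves a direct
  computation.\<close>

definition square :: "'a \<times> 'a \<times> 'a \<Rightarrow> ('a \<times> 'a \<times> 'a) set" where
  "square = (\<lambda>(g, a, b). {(g, a, b), (a \<otimes> g, inv a, b), (g \<otimes> b, a, inv b), (a \<otimes> g \<otimes> b, inv a, inv b)})"

abbreviation "flags \<equiv> carrier G \<times> A \<times> B"

lemma square_left:
  "g \<in> carrier G \<Longrightarrow> a \<in> A \<Longrightarrow> b \<in> B \<Longrightarrow> square (a \<otimes> g, inv a, b) = square (g, a, b)"
  by (auto simp: square_def m_assoc)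

lemma square_right:
  "g \<in> carrier G \<Longrightarrow> a \<in> A \<Longrightarrow> b \<in> B \<Longrightarrow> square (g \<otimes> b, a, inv b) = square (g, a, b)"
  by (auto simp: square_def m_assoc)

text \<open>A flag belongs to its own square, so flags with equal squares lie in one set of at most
  four elements.\<close>

lemma card_squares: "card flags \<le> 4 * card (square ` flags)"
proof (rule card_le_fibres)
  show "finite flags" "finite (square ` flags)" using fin_G L.fin_A R.fin_A by auto
  fix x assume "x \<in> flags"
  have "{y \<in> flags. square y = square x} \<subseteq> square x"
  proof
    fix y assume "y \<in> {y \<in> flags. square y = square x}"
    moreover have "y \<in> square y" by (cases y) (simp add: square_def)
    ultimately show "y \<in> square x" by simp
  qed
  moreover have "card (square x) \<le> 4" "finite (square x)"
    by (auto simp: square_def card_insert_if split: prod.splits)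
  ultimately show "card {y \<in> flags. square y = square x} \<le> 4"
    using card_mono order_trans by blast
qed auto

lemma finite_S: "finite S"
  by (rule finite_subset[of _ "A \<times> B \<rightarrow>\<^sub>E UNIV"])
     (auto simp: tensor_code_def L.fin_A R.fin_A intro: finite_PiE)

lemma finite_Z: "finite Z"
  by (rule finite_subset[of _ "carrier G \<rightarrow>\<^sub>E S"])
     (auto simp: Z0_def fin_G finite_S intro: finite_PiE)

text \<open>
  Words whose local views agree along all edges are labellings of the squares. Adding such a
  word to an arbitrary word over \<open>S\<close> has fibres that are no larger than the code.
\<close>

lemma card_Z_ge:
  "CARD('f) ^ card (square ` flags) * card S ^ card (carrier G)
    \<le> card Z * CARD('f) ^ (card A * card B * card (carrier G))"
proof -
  define Y where "Y = (square ` flags \<rightarrow>\<^sub>E (UNIV :: 'f set))"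
  define T where "T = (carrier G \<rightarrow>\<^sub>E S)"
  define X where "X = (carrier G \<rightarrow>\<^sub>E (A \<times> B \<rightarrow>\<^sub>E (UNIV :: 'f set)))"
  \<comment> \<open>The word induced by a labelling \<open>y\<close> of the squares: each entry of
    the value at \<open>g\<close> is the label of its square.\<close>
  define F :: "_ \<Rightarrow> 'a \<Rightarrow> 'a \<times> 'a \<Rightarrow> 'f" where "F y g p = y (square (g, fst p, snd p))" for y g p
  define h where "h = (\<lambda>(y, t). \<lambda>g\<in>carrier G. \<lambda>p\<in>A \<times> B. F y g p + t g p)"
  have fin_flags: "finite flags" using fin_G L.fin_A R.fin_A by auto
  have fin: "finite Y" "finite T" "finite X"
    using fin_flags fin_G finite_S L.fin_A R.fin_A
    by (auto simp: Y_def T_def X_def intro!: finite_PiE)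
  have F_left: "F y g (a, b) = F y (a \<otimes> g) (inv a, b)"
    and F_right: "F y g (a, b) = F y (g \<otimes> b) (a, inv b)"
    if "g \<in> carrier G" "a \<in> A" "b \<in> B" for y g a b
    using square_left[OF that] square_right[OF that] by (simp_all add: F_def)
  have "card (Y \<times> T) \<le> card Z * card X"
  proof (rule card_le_fibres)
    show "h ` (Y \<times> T) \<subseteq> X"
      by (rule image_subsetI) (simp add: h_def X_def split_beta)
    fix x assume "x \<in> Y \<times> T"
    then obtain y0 t0 where x: "x = (y0, t0)" "y0 \<in> Y" "t0 \<in> T" by auto
    \<comment> \<open>On a fibre of \<open>h\<close> the word \<open>F y - F y0\<close> also equals
      \<open>t0 - t\<close>. The first form satisfies all edge constraints, the second has values in
      \<open>S\<close>, so it is a codeword. This is the counting version of the dimension bound for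
      an intersection.\<close>
    define \<delta> where "\<delta> = (\<lambda>(y, t::'a \<Rightarrow> 'a \<times> 'a \<Rightarrow> 'f). \<lambda>g\<in>carrier G. \<lambda>p\<in>A \<times> B. F y g p - F y0 g p)"
    have eqD: "F y g p + t g p = F y0 g p + t0 g p"
      if "h (y, t) = h x" "g \<in> carrier G" "p \<in> A \<times> B" for y t g p
      using fun_cong[OF fun_cong[OF that(1), of g], of p] that by (simp add: h_def x)
    show "card {z \<in> Y \<times> T. h z = h x} \<le> card Z"
    proof (rule card_inj_on_le[of \<delta>])
      show "inj_on \<delta> {z \<in> Y \<times> T. h z = h x}"
      proof (rule inj_onI, clarify)
        fix y t y' t' assume y: "y \<in> Y" "y' \<in> Y" and t: "t \<in> T" "t' \<in> T"
          and hx: "h (y, t) = h x" "h (y', t') = h x" and d: "\<delta> (y, t) = \<delta> (y', t')"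
        have F: "F y g p = F y' g p" if "g \<in> carrier G" "p \<in> A \<times> B" for g p
          using fun_cong[OF fun_cong[OF d, of g], of p] that by (simp add: \<delta>_def)
        have "y = y'"
        proof (rule PiE_ext[OF y[unfolded Y_def]])
          fix z assume "z \<in> square ` flags"
          then obtain g a b where "g \<in> carrier G" "a \<in> A" "b \<in> B" "z = square (g, a, b)" by auto
          thus "y z = y' z" using F[of g "(a, b)"] by (simp add: F_def)
        qed
        moreover have "t = t'"
        proof (rule PiE_ext[OF t[unfolded T_def]])
          fix g assume g: "g \<in> carrier G"
          hence "t g \<in> S" "t' g \<in> S" using t by (auto simp: T_def)
          thus "t g = t' g"
          proof (rule extensionalityI[OF S_extensional S_extensional])
            fix p assume p: "p \<in> A \<times> B"
            show "t g p = t' g p"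
              using eqD[OF hx(1) g p] eqD[OF hx(2) g p] F[OF g p] by (metis add_left_cancel)
          qed
        qed
        ultimately show "y = y' \<and> t = t'" by simp
      qed
      show "\<delta> ` {z \<in> Y \<times> T. h z = h x} \<subseteq> Z"
      proof clarify
        fix y t assume y: "y \<in> Y" and t: "t \<in> T" and hx: "h (y, t) = h x"
        have eq: "\<delta> (y, t) g = (\<lambda>p\<in>A \<times> B. t0 g p - t g p)" if g: "g \<in> carrier G" for g
        proof
          fix p
          show "\<delta> (y, t) g p = (\<lambda>p\<in>A \<times> B. t0 g p - t g p) p"
            using eqD[OF hx g, of p] g by (auto simp: \<delta>_def diff_eq_eq algebra_simps)
        qed
        have "\<delta> (y, t) g \<in> S" if g: "g \<in> carrier G" for g
          unfolding eq[OF g] using t x g by (intro linear_code_diff[OF S_linear]) (auto simp: T_def)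
        hence "\<delta> (y, t) \<in> carrier G \<rightarrow>\<^sub>E S" by (auto simp: \<delta>_def)
        moreover have "\<not> viol_left (\<delta> (y, t)) g a" if "g \<in> carrier G" "a \<in> A" for g a
          using that F_left[OF that]
          by (auto simp: viol_left_def row_def \<delta>_def fun_eq_iff)
        moreover have "\<not> viol_right (\<delta> (y, t)) g b" if "g \<in> carrier G" "b \<in> B" for g b
          using that F_right[OF that(1) _ that(2)]
          by (auto simp: viol_right_def col_def \<delta>_def fun_eq_iff)
        ultimately show "\<delta> (y, t) \<in> Z" by (auto simp: Z0_iff)
      qed
    qed (rule finite_Z)
  qed (use fin in auto)
  moreover have "card Y = CARD('f) ^ card (square ` flags)"
    using fin_flags by (simp add: Y_def card_PiE)
  moreover have "card T = card S ^ card (carrier G)" using fin_G by (simp add: T_def card_PiE)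
  moreover have "card X = CARD('f) ^ (card A * card B * card (carrier G))"
    using fin_G L.fin_A R.fin_A by (simp add: X_def card_PiE card_cartesian_product power_mult)
  ultimately show ?thesis by (simp add: card_cartesian_product)
qed

text \<open>There are at least |G||A||B|/4 squares, so taking logarithms in \<open>card_Z_ge\<close>
  loses at most 3/4 |G||A||B| ln q against |G| ln|S|. Division by |G| ln|S|, with ln|S| at least
  r(C_A)r(C_B)|A||B| ln q, gives the bound.\<close>

lemma rate_Z_ge:
  assumes "CA \<noteq> {\<lambda>a\<in>A. 0}" and "CB \<noteq> {\<lambda>b\<in>B. 0}"
  shows "rate (carrier G) S Z
    \<ge> (4 * rate A UNIV CA * rate B UNIV CB - 3) / (4 * rate A UNIV CA * rate B UNIV CB)"
proof -
  define q where "q = real CARD('f)"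
  define \<rho>A where "\<rho>A = rate A UNIV CA"
  define \<rho>B where "\<rho>B = rate B UNIV CB"
  define pA where "pA = real (card A)"
  define pB where "pB = real (card B)"
  have "card {0::'f, 1} \<le> CARD('f)" by (intro card_mono) auto
  hence q: "q > 1" by (simp add: q_def)
  hence lq: "ln q > 0" by simp
  have pA: "pA > 0" and pB: "pB > 0" using L.card_A_pos R.card_A_pos by (simp_all add: pA_def pB_def)
  obtain k l where k: "card CA \<le> CARD('f) ^ k" and l: "card CB \<le> CARD('f) ^ l"
    and kl: "CARD('f) ^ (k * l) \<le> card S"
    using card_tensor_code_ge[OF L.fin_A R.fin_A CA_linear CB_linear] by blast
  have card_gt_1: "card C > 1"
    if "linear_code I C" "C \<noteq> {\<lambda>i\<in>I. 0}" "finite I" for I :: "'a set" and C :: "('a \<Rightarrow> 'f) set"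
  proof -
    have z: "(\<lambda>i\<in>I. 0) \<in> C" and sub: "C \<subseteq> I \<rightarrow>\<^sub>E UNIV" using that by (auto simp: linear_code_def)
    with that(2) obtain c where "c \<in> C" "c \<noteq> (\<lambda>i\<in>I. 0)" by blast
    hence "card {\<lambda>i\<in>I. 0, c} \<le> card C"
      using z sub that(3) by (intro card_mono finite_subset[OF sub]) (auto intro: finite_PiE)
    thus ?thesis using \<open>c \<noteq> (\<lambda>i\<in>I. 0)\<close> by (simp split: if_splits)
  qed
  have rate_eq: "rate I UNIV C = ln (real (card C)) / (real (card I) * ln q)"
    if "finite I" for I :: "'a set" and C :: "('a \<Rightarrow> 'f) set"
    using that q by (simp add: rate_def log_def card_PiE q_def ln_realpow)
  have ln_card: "ln (real c) \<le> real k * ln q" if "c \<le> CARD('f) ^ k" "c > 1" for c k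
  proof -
    have "ln (real c) \<le> ln (q ^ k)"
      using that q by (subst ln_le_cancel_iff) (auto simp: q_def simp flip: of_nat_power)
    thus ?thesis using q by (simp add: ln_realpow)
  qed
  have cA: "card CA > 1" and cB: "card CB > 1"
    using card_gt_1 CA_linear CB_linear assms L.fin_A R.fin_A by auto
  have \<rho>: "\<rho>A > 0" "\<rho>B > 0"
    using cA cB lq pA pB L.A_ne R.A_ne by (simp_all add: \<rho>A_def \<rho>B_def rate_eq L.fin_A R.fin_A pA_def pB_def)
  have "\<rho>A * pA = ln (real (card CA)) / ln q" "\<rho>B * pB = ln (real (card CB)) / ln q"
    using pA pB L.A_ne R.A_ne by (simp_all add: \<rho>A_def \<rho>B_def rate_eq L.fin_A R.fin_A pA_def pB_def)
  hence "\<rho>A * pA \<le> real k" "\<rho>B * pB \<le> real l"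
    using ln_card[OF k cA] ln_card[OF l cB] lq by (simp_all add: divide_le_eq)
  hence kl_ge: "(\<rho>A * pA) * (\<rho>B * pB) \<le> real k * real l"
    using \<rho> pA pB by (intro mult_mono) auto
  have "real k * real l * ln q = ln (q ^ (k * l))" using q by (simp add: ln_realpow)
  also have "\<dots> \<le> ln (real (card S))"
    using kl q by (subst ln_le_cancel_iff) (auto simp: q_def simp flip: of_nat_power intro: less_le_trans[OF _ kl])
  finally have S_ge: "real k * real l * ln q \<le> ln (real (card S))" .
  have "0 < (\<rho>A * pA) * (\<rho>B * pB)" using \<rho> pA pB by simp
  hence S_ge': "(\<rho>A * pA) * (\<rho>B * pB) * ln q \<le> ln (real (card S))"
    using S_ge mult_right_mono[OF kl_ge, of "ln q"] lq by linarith
  hence lnS: "ln (real (card S)) > 0"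
    using \<open>0 < (\<rho>A * pA) * (\<rho>B * pB)\<close> lq by (smt (verit) mult_pos_pos)
  hence cS: "card S > 0" by (cases "card S = 0") auto
  have cZ: "card Z > 0" using zero_in_Z finite_Z by (auto simp: card_gt_0_iff)
  define m where "m = real (card (square ` flags))"
  have "real (card flags) \<le> real (4 * card (square ` flags))"
    using card_squares by (simp only: of_nat_le_iff)
  hence m: "n * pA * pB \<le> 4 * m"
    by (simp add: m_def pA_def pB_def card_cartesian_product mult.assoc)
  have "real (CARD('f) ^ card (square ` flags) * card S ^ card (carrier G))
      \<le> real (card Z * CARD('f) ^ (card A * card B * card (carrier G)))"
    using card_Z_ge by (simp only: of_nat_le_iff)
  hence "ln (q ^ card (square ` flags) * real (card S) ^ card (carrier G))
      \<le> ln (real (card Z) * q ^ (card A * card B * card (carrier G)))"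
    using q cS cZ by (subst ln_le_cancel_iff) (auto simp: q_def)
  hence "m * ln q + n * ln (real (card S)) \<le> ln (real (card Z)) + pA * pB * n * ln q"
    using q cS cZ by (simp add: ln_mult ln_realpow m_def pA_def pB_def)
  moreover have "n * pA * pB * ln q \<le> 4 * m * ln q" using m lq by (intro mult_right_mono) auto
  ultimately have Z_ge: "n * ln (real (card S)) - 3 / 4 * (n * (pA * pB * ln q)) \<le> ln (real (card Z))"
    by (simp add: mult_ac)
  have "rate (carrier G) S Z = ln (real (card Z)) / (n * ln (real (card S)))"
    using fin_G cS by (simp add: rate_def log_def card_PiE ln_realpow)
  also have "\<dots> \<ge> (n * ln (real (card S)) - 3 / 4 * (n * (pA * pB * ln q))) / (n * ln (real (card S)))"
    using Z_ge lnS by (intro divide_right_mono) auto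
  also have "(n * ln (real (card S)) - 3 / 4 * (n * (pA * pB * ln q))) / (n * ln (real (card S)))
      = 1 - 3 / 4 * (pA * pB * ln q / ln (real (card S)))"
    using L.card_V_pos lnS by (simp add: field_simps)
  finally have "1 - 3 / 4 * (pA * pB * ln q / ln (real (card S))) \<le> rate (carrier G) S Z" .
  moreover have "pA * pB * ln q / ln (real (card S)) \<le> 1 / (\<rho>A * \<rho>B)"
    using S_ge' lnS \<rho> by (simp add: field_simps)
  moreover have "(4 * \<rho>A * \<rho>B - 3) / (4 * \<rho>A * \<rho>B) = 1 - 3 / 4 * (1 / (\<rho>A * \<rho>B))"
    using \<rho> by (simp add: field_simps)
  ultimately show ?thesis unfolding \<rho>A_def[symmetric] \<rho>B_def[symmetric] by linarith
qed

end

section \<open>Decoding and soundness\<close>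

context tensor_square_complex
begin

section \<open>Distances to codewords\<close>

lemma codeword_row:
  "f \<in> Z \<Longrightarrow> g \<in> carrier G \<Longrightarrow> a \<in> A \<Longrightarrow> row B a (f g) = row B (inv a) (f (a \<otimes> g))"
  unfolding Z0_iff viol_left_def by blast

lemma codeword_col:
  "f \<in> Z \<Longrightarrow> g \<in> carrier G \<Longrightarrow> b \<in> B \<Longrightarrow> col A b (f g) = col A (inv b) (f (g \<otimes> b))"
  unfolding Z0_iff viol_right_def by blast

text \<open>If the words differ at g, some column differs there, hence in at least \<epsilon>|A|
  entries. Each such entry lies in a row shared with ag, so the words differ at ag too. The support
  thus keeps a fraction \<epsilon> of its left neighbours, which forces density at least \<epsilon>
  - \<epsilon>^2/2500; the constant is 0.9996 = 1 - 1/2500.\<close>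

lemma codeword_min_dist:
  assumes f: "f \<in> Z" and h: "h \<in> Z" and ne: "f \<noteq> h"
  shows "0.9996 * \<epsilon> \<le> hdist (carrier G) f h"
proof -
  define X where "X = {g \<in> carrier G. f g \<noteq> h g}"
  have fS: "f \<in> carrier G \<rightarrow>\<^sub>E S" and hS: "h \<in> carrier G \<rightarrow>\<^sub>E S"
    using f h by (auto simp: Z0_iff)
  have "X \<noteq> {}"
    using ne PiE_ext[OF fS hS] by (auto simp: X_def)
  hence X: "real (card X) > 0" using fin_G by (auto simp: X_def card_gt_0_iff)
  have dense: "\<epsilon> \<le> L.avg (\<lambda>g. of_bool (g \<in> X)) g" if "g \<in> X" for g
  proof -
    have g: "g \<in> carrier G" and S: "f g \<in> S" "h g \<in> S" and "f g \<noteq> h g"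
      using that fS hS by (auto simp: X_def)
    hence "\<exists>p\<in>A \<times> B. f g p \<noteq> h g p"
      using extensionalityI[OF S_extensional S_extensional] by metis
    then obtain a b where ab: "a \<in> A" "b \<in> B" "f g (a, b) \<noteq> h g (a, b)" by auto
    hence "col A b (f g) a \<noteq> col A b (h g) a" by (simp add: col_def)
    hence "col A b (f g) \<noteq> col A b (h g)" by metis
    hence "\<epsilon> \<le> hdist A (col A b (f g)) (col A b (h g))"
      using ab S by (intro min_distD[OF CA_dist] col_in_CA) auto
    also have "\<dots> = edge_fraction A (\<lambda>g a. col A b (f g) a \<noteq> col A b (h g) a) g"
      by (simp add: hdist_def edge_fraction_def)
    also have "\<dots> \<le> edge_fraction A (\<lambda>g a. a \<otimes> g \<in> X) g"
    proof (rule edge_fraction_mono[OF L.fin_A])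
      fix a assume a: "a \<in> A" and "col A b (f g) a \<noteq> col A b (h g) a"
      hence "row B a (f g) b \<noteq> row B a (h g) b" using ab by (simp add: row_def col_def)
      hence "row B a (f g) \<noteq> row B a (h g)" by metis
      moreover have "row B a (f g) = row B (inv a) (f (a \<otimes> g))"
        "row B a (h g) = row B (inv a) (h (a \<otimes> g))"
        using f h a g by (blast intro: codeword_row)+
      ultimately show "a \<otimes> g \<in> X" using a g by (auto simp: X_def)
    qed
    also have "\<dots> = L.avg (\<lambda>g. of_bool (g \<in> X)) g"
      by (simp add: edge_fraction_altdef L.fin_A L.avg_def del: sum_of_bool_eq)
    finally show ?thesis .
  qed
  have "\<epsilon> * real (card X) = (\<Sum>g\<in>carrier G. of_bool (g \<in> X) * \<epsilon>)"
    using fin_G by (simp add: X_def Int_def mult.commute)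
  also have "\<dots> \<le> (\<Sum>g\<in>carrier G. of_bool (g \<in> X) * L.avg (\<lambda>g. of_bool (g \<in> X)) g)"
    using dense by (intro sum_mono) auto
  also have "\<dots> \<le> (hdist (carrier G) f h + \<epsilon>\<^sup>2 / 2500) * real (card X)"
    using L.card_V_pos by (intro LE.small_set_avg) (auto simp: X_def hdist_def)
  finally have "\<epsilon> \<le> hdist (carrier G) f h + \<epsilon>\<^sup>2 / 2500" using X by simp
  moreover have "\<epsilon>\<^sup>2 \<le> \<epsilon>" using \<epsilon>_pos \<epsilon>_le_1 by (simp add: power2_eq_square mult_left_le)
  ultimately show ?thesis by simp
qed

text \<open>A violated edge has an end where \<open>f\<close> and \<open>h\<close> differ, and the
  left edges at a vertex weigh 1/|G| together, as do the right ones.\<close>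

lemma weight_le_dist:
  assumes h: "h \<in> Z"
  shows "W f \<le> 2 * hdist (carrier G) f h"
proof -
  define d :: "'a \<Rightarrow> real" where "d g = of_bool (f g \<noteq> h g)" for g
  have d: "(\<Sum>g\<in>carrier G. d g) = n * hdist (carrier G) f h"
    using fin_G L.card_V_pos by (simp add: d_def hdist_def Int_def)
  have left: "of_bool (viol_left f g a) \<le> d g + d (a \<otimes> g)" if "g \<in> carrier G" "a \<in> A" for g a
    using codeword_row[OF h that] by (auto simp: viol_left_def d_def)
  have right: "of_bool (viol_right f g b) \<le> d g + d (g \<otimes> b)" if "g \<in> carrier G" "b \<in> B" for g b
    using codeword_col[OF h that] by (auto simp: viol_right_def d_def)
  have "(\<Sum>g\<in>carrier G. edge_fraction A (viol_left f) g)
      \<le> (\<Sum>g\<in>carrier G. \<Sum>a\<in>A. d g + d (a \<otimes> g)) / real (card A)"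
    unfolding edge_fraction_altdef[OF L.fin_A] sum_divide_distrib[symmetric]
    by (intro divide_right_mono sum_mono left) auto
  also have "(\<Sum>g\<in>carrier G. \<Sum>a\<in>A. d g + d (a \<otimes> g)) = 2 * (\<Sum>g\<in>carrier G. \<Sum>a\<in>A. d g)"
    using L.sum_reverse_edges[of "\<lambda>g a. d g"] by (simp only: sum.distrib)
  finally have L: "(\<Sum>g\<in>carrier G. edge_fraction A (viol_left f) g) \<le> 2 * n * hdist (carrier G) f h"
    using L.card_A_pos d by (simp add: sum_distrib_left[symmetric])
  have "(\<Sum>g\<in>carrier G. edge_fraction B (viol_right f) g)
      \<le> (\<Sum>g\<in>carrier G. \<Sum>b\<in>B. d g + d (g \<otimes> b)) / real (card B)"
    unfolding edge_fraction_altdef[OF R.fin_A] sum_divide_distrib[symmetric]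
    by (intro divide_right_mono sum_mono right) auto
  also have "(\<Sum>g\<in>carrier G. \<Sum>b\<in>B. d g + d (g \<otimes> b)) = 2 * (\<Sum>g\<in>carrier G. \<Sum>b\<in>B. d g)"
    using R.sum_reverse_edges[of "\<lambda>g b. d g"] by (simp only: sum.distrib)
  finally have "(\<Sum>g\<in>carrier G. edge_fraction B (viol_right f) g) \<le> 2 * n * hdist (carrier G) f h"
    using R.card_A_pos d by (simp add: sum_distrib_left[symmetric])
  with L have "2 * n * W f \<le> 2 * n * (2 * hdist (carrier G) f h)"
    unfolding sum_load[symmetric] load_def by (simp add: sum.distrib)
  thus ?thesis using L.card_V_pos by (simp only: mult_le_cancel_left_pos)
qed

section \<open>Runs of the Correction Algorithm\<close>

abbreviation "step \<equiv> correction_step G A B S (\<epsilon> / 100)"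

lemma step_closed:
  assumes f: "f \<in> carrier G \<rightarrow>\<^sub>E S" and "step f f'"
  shows "f' \<in> carrier G \<rightarrow>\<^sub>E S" "hdist (carrier G) f f' \<le> 1 / n" "W f' < W f - \<epsilon> / 100 / n"
proof -
  from assms(2) obtain g m where g: "g \<in> carrier G" and m: "m \<in> S"
    and f': "f' = f(g := (\<lambda>p\<in>A \<times> B. f g p + m p))" and W: "W f' < W f - \<epsilon> / 100 / n"
    unfolding correction_step_def by blast
  have "f g \<in> S" using f g by auto
  with m have "(\<lambda>p\<in>A \<times> B. f g p + m p) \<in> S"
    using S_linear unfolding linear_code_def by blast
  thus "f' \<in> carrier G \<rightarrow>\<^sub>E S" using f g unfolding f' by (auto simp: PiE_iff extensional_def)
  have "card {x \<in> carrier G. f x \<noteq> f' x} \<le> card {g}" by (intro card_mono) (auto simp: f')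
  thus "hdist (carrier G) f f' \<le> 1 / n" by (simp add: hdist_def divide_right_mono)
qed (use assms(2) in \<open>auto simp: correction_step_def\<close>)

text \<open>A step moves the word by at most 1/|G| and pays for it with a weight drop above
  \<epsilon>/(100|G|), so the distance travelled is bounded by the weight lost.\<close>

lemma steps_closed:
  assumes "step\<^sup>*\<^sup>* f h" and f: "f \<in> carrier G \<rightarrow>\<^sub>E S"
  shows "h \<in> carrier G \<rightarrow>\<^sub>E S \<and> \<epsilon> / 100 * hdist (carrier G) f h \<le> W f - W h"
  using assms(1)
proof (induction rule: rtranclp_induct)
  case base
  thus ?case using f by (simp add: hdist_def)
next
  case (step h h')
  have "hdist (carrier G) f h' \<le> hdist (carrier G) f h + 1 / n"
    using hdist_triangle[OF fin_G, of f h' h] step_closed(2)[of h h'] step by linarith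
  hence "\<epsilon> / 100 * hdist (carrier G) f h' \<le> \<epsilon> / 100 * (hdist (carrier G) f h + 1 / n)"
    using \<epsilon>_pos by (intro mult_left_mono) auto
  also have "\<dots> = \<epsilon> / 100 * hdist (carrier G) f h + \<epsilon> / 100 / n" by (simp add: distrib_left)
  finally show ?case using step_closed[of h h'] step by auto
qed

lemma correction_terminates:
  assumes f: "f \<in> carrier G \<rightarrow>\<^sub>E S"
  shows "correction_terminates G A B S (\<epsilon> / 100) f"
  unfolding correction_terminates_def
proof
  assume "\<exists>s. s 0 = f \<and> (\<forall>i::nat. step (s i) (s (Suc i)))"
  then obtain s where s: "s 0 = f" "\<And>i::nat. step (s i) (s (Suc i))" by blast
  define c where "c = \<epsilon> / 100 / n"
  have c: "c > 0" using \<epsilon>_pos L.card_V_pos by (simp add: c_def)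
  have "s k \<in> carrier G \<rightarrow>\<^sub>E S \<and> W (s k) \<le> W f - real k * c" for k
  proof (induction k)
    case (Suc k)
    with step_closed(1,3)[OF _ s(2)[of k], folded c_def] show ?case
      by (simp add: ring_distribs)
  qed (use s f in auto)
  hence "real k * c \<le> W f" for k
    using violation_weight_nonneg[of "s k"] by (smt (verit))
  moreover obtain k where "W f < real k * c" using reals_Archimedean3[OF c] by blast
  ultimately show False by (meson not_le)
qed

lemma correction_output_exists:
  assumes f: "f \<in> carrier G \<rightarrow>\<^sub>E S"
  shows "\<exists>h. correction_output G A B S (\<epsilon> / 100) f h"
proof (rule ccontr)
  assume no: "\<not> ?thesis"
  have "\<exists>s. s 0 = f \<and> (\<forall>i. step\<^sup>*\<^sup>* f (s i) \<and> step (s i) (s (Suc i)))"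
  proof -
    \<comment> \<open>If every reachable word admits a step, dependent choice builds an infinite
      run; the clause for \<open>i = 0\<close> pins its start at \<open>f\<close>.\<close>
    have "\<exists>s. \<forall>i. (step\<^sup>*\<^sup>* f (s i) \<and> (i = 0 \<longrightarrow> s i = f)) \<and> step (s i) (s (Suc i))"
    proof (rule dependent_nat_choice)
      fix x and i :: nat assume "step\<^sup>*\<^sup>* f x \<and> (i = 0 \<longrightarrow> x = f)"
      moreover from this obtain y where "step x y" using no unfolding correction_output_def by blast
      ultimately show "\<exists>y. (step\<^sup>*\<^sup>* f y \<and> (Suc i = 0 \<longrightarrow> y = f)) \<and> step x y"
        using rtranclp.rtrancl_into_rtrancl[of step f x y] by auto
    qed auto
    thus ?thesis by blast
  qed
  thus False using correction_terminates[OF f] unfolding correction_terminates_def by blast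
qed

text \<open>The weight only decreases along a run, so the output is still light, and it is stuck by
  definition.\<close>

lemma output_near_codeword:
  assumes f: "f \<in> carrier G \<rightarrow>\<^sub>E S" and "W f < 2 / M"
    and out: "correction_output G A B S (\<epsilon> / 100) f h"
  shows "h \<in> Z" "\<epsilon> / 100 * hdist (carrier G) f h \<le> W f"
proof -
  have h: "h \<in> carrier G \<rightarrow>\<^sub>E S \<and> \<epsilon> / 100 * hdist (carrier G) f h \<le> W f - W h"
    using out f by (intro steps_closed) (auto simp: correction_output_def)
  show "\<epsilon> / 100 * hdist (carrier G) f h \<le> W f" using h violation_weight_nonneg[of h] by linarith
  have "\<epsilon> / 100 * hdist (carrier G) f h \<ge> 0" using \<epsilon>_pos by (simp add: hdist_def)
  with h assms(2) have "W h < 2 / M" by linarith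
  thus "h \<in> Z" using h out by (intro stuck_light_is_codeword) (auto simp: correction_output_def)
qed

text \<open>The output is a codeword known only to lie within \<open>200 / (\<epsilon> * M)\<close>
  of \<open>f\<close>, which may exceed the radius \<open>1 / M\<close>. This still lies far below
  the minimum distance, so the output must be the codeword within \<open>1 / M\<close>.\<close>

lemma correction_decodes: "correction_decodes G A B S (\<epsilon> / 100) (1 / M)"
  unfolding correction_decodes_def
proof (intro ballI impI conjI allI)
  fix f assume f: "f \<in> carrier G \<rightarrow>\<^sub>E S" and near: "hdist_code (carrier G) f Z < 1 / M"
  have \<epsilon>2: "\<epsilon>\<^sup>2 \<le> \<epsilon>" using \<epsilon>_pos \<epsilon>_le_1 by (simp add: power2_eq_square mult_left_le)
  have "1 / M \<le> \<epsilon> ^ 3 / 250000" using M_bounds(1,4) \<epsilon>_pos by (simp add: field_simps)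
  hence "200 / \<epsilon> * (1 / M) \<le> 200 / \<epsilon> * (\<epsilon> ^ 3 / 250000)" using \<epsilon>_pos by (intro mult_left_mono) auto
  also have "\<dots> = \<epsilon>\<^sup>2 / 1250" using \<epsilon>_pos by (simp add: power2_eq_square power3_eq_cube)
  finally have r: "200 / \<epsilon> * (1 / M) \<le> \<epsilon> / 1250" using \<epsilon>2 by linarith
  have "1 \<le> 200 / \<epsilon>" using \<epsilon>_pos \<epsilon>_le_1 by (simp add: le_divide_eq)
  from mult_right_mono[OF this, of "1 / M"] have "1 / M \<le> 200 / \<epsilon> * (1 / M)"
    using M_bounds(4) by simp
  with r have r': "1 / M \<le> \<epsilon> / 1250" by linarith
  \<comment> \<open>The asymmetric radii cover both uses: uniqueness within \<open>1 / M\<close>,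
    and identification of the output at its weaker distance.\<close>
  have unique: "h = h'" if "h \<in> Z" "h' \<in> Z" "hdist (carrier G) f h < 1 / M"
    "hdist (carrier G) f h' \<le> 200 / \<epsilon> * (1 / M)" for h h'
  proof (rule ccontr)
    assume "h \<noteq> h'"
    hence "0.9996 * \<epsilon> \<le> hdist (carrier G) h h'" using that by (intro codeword_min_dist)
    also have "\<dots> \<le> hdist (carrier G) f h + hdist (carrier G) f h'"
      using hdist_triangle[OF fin_G, of h h' f] by (simp add: hdist_commute)
    also have "\<dots> < \<epsilon> / 1250 + \<epsilon> / 1250" using that r r' by linarith
    finally show False using \<epsilon>_pos by simp
  qed
  from near zero_in_Z obtain h where h: "h \<in> Z" "hdist (carrier G) f h < 1 / M"
    using hdist_code_lessD[of "carrier G" f Z] by blast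
  show "\<exists>!h. h \<in> Z \<and> hdist (carrier G) f h < 1 / M"
  proof (rule ex1I[of _ h])
    fix h' assume "h' \<in> Z \<and> hdist (carrier G) f h' < 1 / M"
    thus "h' = h" using h \<open>1 / M \<le> 200 / \<epsilon> * (1 / M)\<close> by (intro unique[symmetric]) auto
  qed (use h in auto)
  show "correction_terminates G A B S (\<epsilon> / 100) f" by (rule correction_terminates[OF f])
  fix h' assume out: "correction_output G A B S (\<epsilon> / 100) f h'"
  have W: "W f < 2 / M" using weight_le_dist[OF h(1), of f] h(2) by simp
  have Z: "h' \<in> Z" by (rule output_near_codeword(1)[OF f W out])
  have "\<epsilon> / 100 * hdist (carrier G) f h' \<le> 2 / M"
    using output_near_codeword(2)[OF f W out] W by linarith
  from mult_left_mono[OF this, of "100 / \<epsilon>"] have "hdist (carrier G) f h' \<le> 200 / \<epsilon> * (1 / M)"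
    using \<epsilon>_pos by simp
  with unique[OF h(1) Z h(2)] h show "h' \<in> Z" "hdist (carrier G) f h' < 1 / M" by auto
qed

text \<open>For light words the output of a run is a codeword close to \<open>f\<close>. For all
  others \<open>M * W f\<close> is at least 2, while distances never exceed 1.\<close>

lemma dist_le_weight:
  assumes f: "f \<in> carrier G \<rightarrow>\<^sub>E S"
  shows "hdist_code (carrier G) f Z \<le> M * W f"
proof (cases "W f < 2 / M")
  case True
  obtain h where out: "correction_output G A B S (\<epsilon> / 100) f h"
    using correction_output_exists[OF f] by blast
  have "hdist_code (carrier G) f Z \<le> hdist (carrier G) f h"
    by (intro hdist_code_le output_near_codeword(1)[OF f True out])
  also have "\<dots> \<le> 100 / \<epsilon> * W f"
    using output_near_codeword(2)[OF f True out] \<epsilon>_pos by (simp add: field_simps)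
  also have "100 / \<epsilon> \<le> 4800 / \<epsilon>" using \<epsilon>_pos by (intro divide_right_mono) auto
  hence "100 / \<epsilon> * W f \<le> M * W f"
    using M_bounds(5) violation_weight_nonneg by (intro mult_right_mono) auto
  finally show ?thesis .
next
  case False
  have "hdist_code (carrier G) f Z \<le> 1"
    using hdist_code_le[OF zero_in_Z] hdist_bounds(1)[OF fin_G] order_trans by blast
  also have "1 \<le> M * W f" using False M_bounds(4) by (simp add: field_simps)
  finally show ?thesis .
qed

section \<open>From the violation weight to the rejection probability\<close>

lemma finite_square_edges: "finite (square_edges G A B)"
  by (simp add: square_edges_def left_edges right_edges L.finite_edges R.finite_edges)

lemma square_edges_nonempty: "square_edges G A B \<noteq> {}"
  using L.A_ne L.V_ne by (auto simp: square_edges_def left_edges L.edges_def)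

lemma card_square_edges:
  "2 * real (card (square_edges G A B)) = n * (real (card A) + real (card B))"
proof -
  have "2 * card (square_edges G A B) = 2 * card L.edges + 2 * card R.edges"
    using edges_disjoint by (simp add: square_edges_def left_edges right_edges card_Un_disjoint
        L.finite_edges R.finite_edges)
  also have "\<dots> = card (carrier G) * (card A + card B)"
    by (simp add: L.card_edges R.card_edges distrib_left)
  finally show ?thesis by (simp flip: of_nat_add of_nat_mult)
qed

lemma violated_restrict: "violated G A B (restrict f e) e = violated G A B f e"
  unfolding violated_def by (intro arg_cong2[where f="(\<or>)"] bex_cong refl) auto

lemma reject_prob_eq:
  "reject_prob (natural_tester G A B) f
    = real (card {e \<in> square_edges G A B. violated G A B f e}) / real (card (square_edges G A B))"
proof -
  have "reject_prob (natural_tester G A B) f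
      = measure_pmf.prob (pmf_of_set (square_edges G A B)) {e. violated G A B f e}"
    by (simp add: reject_prob_def natural_tester_def vimage_def violated_restrict)
  also have "\<dots> = real (card (square_edges G A B \<inter> {e. violated G A B f e})) / real (card (square_edges G A B))"
    by (rule measure_pmf_of_set[OF square_edges_nonempty finite_square_edges])
  finally show ?thesis by (simp add: Int_def)
qed

lemma natural_tester_is_tester: "is_tester 2 (carrier G) Z (natural_tester G A B)"
  unfolding is_tester_def
proof (intro conjI ballI)
  fix x assume "x \<in> set_pmf (natural_tester G A B)"
  then obtain e D where x: "x = (e, D)" and e: "e \<in> square_edges G A B"
    using set_pmf_of_set[OF square_edges_nonempty finite_square_edges]
    by (auto simp: natural_tester_def)
  from e consider g a where "g \<in> carrier G" "a \<in> A" "e = {g, a \<otimes> g}"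
    | g b where "g \<in> carrier G" "b \<in> B" "e = {g, g \<otimes> b}"
    unfolding square_edges_def cay_left_edges_def cay_right_edges_def by blast
  thus "case x of (Q, D) \<Rightarrow> Q \<subseteq> carrier G \<and> finite Q \<and> card Q \<le> 2"
    by cases (auto simp: x card_insert_if)
next
  fix f assume f: "f \<in> Z"
  have "\<not> violated G A B f e" if "e \<in> square_edges G A B" for e
    using that f by (auto simp: square_edges_def left_edges right_edges L.edges_def R.edges_def
        Z0_iff violated_left violated_right)
  hence "square_edges G A B \<inter> {e. \<not> violated G A B f e} = square_edges G A B" by auto
  hence "measure_pmf.prob (pmf_of_set (square_edges G A B)) {e. \<not> violated G A B f e} = 1"
    using square_edges_nonempty finite_square_edges by (simp add: measure_pmf_of_set)
  thus "measure_pmf.prob (natural_tester G A B) {(Q, D). D (restrict f Q)} = 1"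
    by (simp add: natural_tester_def vimage_def violated_restrict)
qed

text \<open>The tester draws edges uniformly, whereas \<open>W\<close> weighs the two kinds by 1/|A|
  and 1/|B|. With x the maximum of the two ratios, |A| + |B| is at most 2x|A| and at most 2x|B|,
  which gives \<open>W f \<le> x * reject_prob\<close>; the rest is
  \<open>dist_le_weight\<close>.\<close>

lemma natural_tester_sound:
  "has_soundness (carrier G) S Z (natural_tester G A B)
    (1 / (max (real (card A) / real (card B)) (real (card B) / real (card A)) * M))"
  unfolding has_soundness_def
proof
  fix f assume f: "f \<in> carrier G \<rightarrow>\<^sub>E S"
  define p where "p = real (card A)"
  define q where "q = real (card B)"
  define x where "x = max (p / q) (q / p)"
  define K where "K = real (card {e \<in> L.edges. violated G A B f e})"
  define J where "J = real (card {e \<in> R.edges. violated G A B f e})"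
  have p: "p > 0" and q: "q > 0" using L.card_A_pos R.card_A_pos by (simp_all add: p_def q_def)
  have "p / q > 0" using p q by simp
  hence x0: "x > 0" by (simp add: x_def less_max_iff_disj)
  have "1 \<le> x" using p q by (cases "p \<le> q") (auto simp: x_def le_max_iff_disj)
  hence "p \<le> x * p" "q \<le> x * q" using p q by auto
  moreover have "q \<le> x * p" "p \<le> x * q"
    using p q mult_right_mono[of "q / p" x p] mult_right_mono[of "p / q" x q] by (auto simp: x_def)
  ultimately have *: "p + q \<le> 2 * x * p" "p + q \<le> 2 * x * q" by auto
  have "{e \<in> square_edges G A B. violated G A B f e}
      = {e \<in> L.edges. violated G A B f e} \<union> {e \<in> R.edges. violated G A B f e}"
    by (auto simp: square_edges_def left_edges right_edges)
  moreover have "card ({e \<in> L.edges. violated G A B f e} \<union> {e \<in> R.edges. violated G A B f e})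
      = card {e \<in> L.edges. violated G A B f e} + card {e \<in> R.edges. violated G A B f e}"
    using edges_disjoint L.finite_edges R.finite_edges by (intro card_Un_disjoint) auto
  ultimately have "real (card {e \<in> square_edges G A B. violated G A B f e}) = K + J"
    by (simp add: K_def J_def)
  moreover have "real (card (square_edges G A B)) = n * (p + q) / 2"
    using card_square_edges by (simp add: p_def q_def)
  ultimately have rej: "reject_prob (natural_tester G A B) f = 2 * (K + J) / (n * (p + q))"
    by (simp only: reject_prob_eq) simp
  have "W f = (K / p + J / q) / n"
    by (simp add: violation_weight_card K_def J_def p_def q_def add_divide_distrib)
  also have "K / p \<le> K * (2 * x / (p + q))"
    using *(1) p q mult_left_mono[of "1 / p" "2 * x / (p + q)" K] by (simp add: field_simps K_def)
  also have "J / q \<le> J * (2 * x / (p + q))"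
    using *(2) p q mult_left_mono[of "1 / q" "2 * x / (p + q)" J] by (simp add: field_simps J_def)
  finally have "W f \<le> (K * (2 * x / (p + q)) + J * (2 * x / (p + q))) / n"
    by (simp add: divide_right_mono)
  also have "\<dots> = x * reject_prob (natural_tester G A B) f"
    unfolding rej distrib_right[symmetric]
    by (simp only: times_divide_eq_left times_divide_eq_right divide_divide_eq_left mult_ac)
  finally have "M * W f \<le> M * (x * reject_prob (natural_tester G A B) f)"
    using M_bounds(4) by (intro mult_left_mono) auto
  hence "hdist_code (carrier G) f Z \<le> x * M * reject_prob (natural_tester G A B) f"
    using dist_le_weight[OF f] by (simp add: mult.assoc mult.left_commute)
  thus "1 / (max (real (card A) / real (card B)) (real (card B) / real (card A)) * M)
      * hdist_code (carrier G) f Z \<le> reject_prob (natural_tester G A B) f"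
    unfolding p_def[symmetric] q_def[symmetric] x_def[symmetric]
    using x0 M_bounds(4) by (simp add: divide_le_eq mult.commute)
qed

end

theorem theorem9p7:
  fixes G :: "('g, 'm) monoid_scheme"
    and A B :: "'g set"
    and CA CB :: "('g \<Rightarrow> 'f::{field, finite}) set"
    and \<epsilon> :: real
  defines "S \<equiv> tensor_code A B CA CB"
    and "M \<equiv> 250000 / \<epsilon> ^ 3 + 4800 * max (real (card A)) (real (card B)) / \<epsilon>"
  assumes "group G" and "finite (carrier G)"
    and "A \<subseteq> carrier G - {\<one>\<^bsub>G\<^esub>}" and "B \<subseteq> carrier G - {\<one>\<^bsub>G\<^esub>}"
    and "generate G A = carrier G" and "generate G B = carrier G"
    and "(\<lambda>a. inv\<^bsub>G\<^esub> a) ` A = A" and "(\<lambda>b. inv\<^bsub>G\<^esub> b) ` B = B"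
    and "\<forall>a\<in>A. \<forall>b\<in>B. \<forall>g\<in>carrier G. g \<otimes>\<^bsub>G\<^esub> a \<otimes>\<^bsub>G\<^esub> inv\<^bsub>G\<^esub> g \<noteq> b"
    and "linear_code A CA" and "CA \<noteq> {\<lambda>a\<in>A. 0}"
    and "linear_code B CB" and "CB \<noteq> {\<lambda>b\<in>B. 0}"
    and "0 < \<epsilon>" and "\<epsilon> \<le> 1"
    and "min_dist A CA \<ge> ereal \<epsilon>"
    and "min_dist B CB \<ge> ereal \<epsilon>"
    and "agreement_testable A B CA CB \<epsilon>"
    and "expander (carrier G) (cay_left_edges G A) (\<epsilon>\<^sup>2 / 2500)"
    and "expander (carrier G) (cay_right_edges G B) (\<epsilon>\<^sup>2 / 2500)"
  shows "min_dist (carrier G) (Z0 G A B S) \<ge> ereal (0.9996 * \<epsilon>) \<and>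
    rate (carrier G) S (Z0 G A B S)
      \<ge> (4 * rate A UNIV CA * rate B UNIV CB - 3) / (4 * rate A UNIV CA * rate B UNIV CB) \<and>
    is_tester 2 (carrier G) (Z0 G A B S) (natural_tester G A B) \<and>
    has_soundness (carrier G) S (Z0 G A B S) (natural_tester G A B)
      (1 / (max (real (card A) / real (card B)) (real (card B) / real (card A)) * M)) \<and>
    correction_decodes G A B S (\<epsilon> / 100) (1 / M)"
proof -
  interpret group G by fact
  \<comment> \<open>\<open>expander\<close> includes a positive degree, which an empty generating
    set could not provide.\<close>
  have nonempty: "X \<noteq> {}"
    if "expander (carrier G) E (\<epsilon>\<^sup>2 / 2500)" "X = {} \<Longrightarrow> E = {}" for E and X :: "'g set"
    using that one_closed by (auto simp: expander_def regular_graph_def neighbours_def)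
  have "A \<noteq> {}" "B \<noteq> {}"
    by (rule nonempty[OF assms(21)] nonempty[OF assms(22)];
        simp add: cay_left_edges_def cay_right_edges_def)+
  then interpret T: tensor_square_complex G A B CA CB \<epsilon>
    using assms by unfold_locales auto
  have M: "M = T.M" by (simp add: M_def T.M_def)
  have "min_dist (carrier G) (Z0 G A B S) \<ge> ereal (0.9996 * \<epsilon>)"
    unfolding min_dist_def S_def
    by (rule INF_greatest, clarify, simp only: prod.case ereal_less_eq, rule T.codeword_min_dist)
  thus ?thesis
    unfolding M S_def
    using T.rate_Z_ge T.natural_tester_is_tester T.natural_tester_sound T.correction_decodes assms
    by blast
qed

end
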